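(* Let $\Lambda$ be a finite lattice (a finite set of sites), $N\ge 2$ an integer, $U>0$, and let $\mathsf{T}=(t_{x,y})_{x,y\in\Lambda}$ be a Hermitian positive semidefinite matrix ($\mathsf{T}\ge 0$) whose kernel $\mathfrak{h}_0=\ker\mathsf{T}\subset\mathbb{C}^{|\Lambda|}$ has dimension $D_0>0$. Let $\mathsf{P}_0$ be the orthogonal projection matrix onto $\mathfrak{h}_0$ and let $\Lambda_0=\{x\in\Lambda\mid(\mathsf{P}_0)_{x,x}\neq 0\}$. Consider the SU($N$) Hubbard Hamiltonian $$\hat H_{\mathrm{Hub}}=\sum_{\alpha=1}^N\sum_{x,y\in\Lambda}t_{x,y}\,\hat c_{x,\alpha}^\dagger\hat c_{y,\alpha}+U\sum_{1\le\alpha<\beta\le N}\sum_{x\in\Lambda}\hat n_{x,\alpha}\hat n_{x,\beta}$$ with total fermion number $N_c=D_0$. Then the model exhibits SU($N$) ferromagnetism if and only if the $|\Lambda_0|\times|\Lambda_0|$ matrix $\big((\mathsf{P}_0)_{x,y}\big)_{x,y\in\Lambda_0}$ is irreducible.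
   Context: Fermions: $\hat c_{x,\alpha}^\dagger,\hat c_{x,\alpha}$ ($x\in\Lambda$, color $\alpha=1,\dots,N$) are fermionic creation and annihilation operators with $\{\hat c_{x,\alpha},\hat c_{y,\beta}\}=\{\hat c^\dagger_{x,\alpha},\hat c^\dagger_{y,\beta}\}=0$ and $\{\hat c_{x,\alpha},\hat c^\dagger_{y,\beta}\}=\delta_{\alpha,\beta}\delta_{x,y}$, acting on their Fock space $\mathcal{H}(\Lambda)$. Number operators: $\hat n_{x,\alpha}=\hat c^\dagger_{x,\alpha}\hat c_{x,\alpha}$ and $\hat N_c=\sum_{x\in\Lambda}\sum_{\alpha=1}^N\hat n_{x,\alpha}$. The sector with fermion number $N_c$ is $\mathcal{H}_{N_c}(\Lambda)=\{|\Phi\rangle\in\mathcal{H}(\Lambda)\mid\hat N_c|\Phi\rangle=N_c|\Phi\rangle\}$; $\hat H_{\mathrm{Hub}}$ preserves it. Color operators: $\hat F^{\alpha,\beta}=\sum_{x\in\Lambda}\hat c^\dagger_{x,\alpha}\hat c_{x,\beta}$ for $\alpha,\beta=1,\dots,N$. Quadratic Casimir operator: $\hat C_2=\frac12\Big(\sum_{\alpha,\beta=1}^N\hat F^{\alpha,\beta}\hat F^{\beta,\alpha}-\frac{\hat N_c^2}{N}\Big)$. SU($N$) ferromagnetism: the model with total fermion number $N_c$ exhibits SU($N$) ferromagnetism if any ground state $|\Phi_{\mathrm{GS}}\rangle$ (any eigenvector of $\hat H_{\mathrm{Hub}}$ restricted to $\mathcal{H}_{N_c}(\Lambda)$ with the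 lowest eigenvalue) has the maximum eigenvalue of $\hat C_2$ in $\mathcal{H}_{N_c}(\Lambda)$, i.e. $\hat C_2|\Phi_{\mathrm{GS}}\rangle=\frac{N_c(N-1)}{2}\left(\frac{N_c}{N}+1\right)|\Phi_{\mathrm{GS}}\rangle$. Irreducibility: the matrix $((\mathsf{P}_0)_{x,y})_{x,y\in\Lambda_0}$ is reducible if and only if $\Lambda_0$ can be decomposed as $\Lambda_0=\Lambda_1\cup\Lambda_2$ with $\Lambda_1\cap\Lambda_2=\emptyset$, $\Lambda_1\ne\emptyset$, $\Lambda_2\neq\emptyset$, so that $(\mathsf{P}_0)_{x,y}=0$ for any $x\in\Lambda_1$ and $y\in\Lambda_2$. It is irreducible if it is not reducible. *)

theory Defs
  imports "HOL-Analysis.Analysis" "HOL-Library.Countable"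
begin

section \<open>Matrices over the lattice\<close>

definition cinner :: "complex ^ 'i \<Rightarrow> complex ^ 'i \<Rightarrow> complex"
  where "cinner v w = (\<Sum>i\<in>UNIV. cnj (v $ i) * w $ i)"

definition hermitian :: "complex ^ 'i ^ 'i \<Rightarrow> bool"
  where "hermitian A \<longleftrightarrow> (\<forall>i j. A $ i $ j = cnj (A $ j $ i))"

text \<open>The quadratic form of a Hermitian matrix is real, so comparing its real part with 0 loses
  nothing.\<close>

definition pos_semidef :: "complex ^ 'i ^ 'i \<Rightarrow> bool"
  where "pos_semidef A \<longleftrightarrow> hermitian A \<and> (\<forall>v. 0 \<le> Re (cinner v (A *v v)))"

definition mat_kernel :: "complex ^ 'i ^ 'i \<Rightarrow> (complex ^ 'i) set"
  where "mat_kernel A = {v. A *v v = 0}"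

text \<open>For a subspace \<open>S\<close> there is exactly one such matrix \<open>P\<close>.\<close>

definition is_orth_proj :: "complex ^ 'i ^ 'i \<Rightarrow> (complex ^ 'i) set \<Rightarrow> bool"
  where "is_orth_proj P S \<longleftrightarrow>
    (\<forall>v. P *v v \<in> S \<and> (\<forall>w\<in>S. cinner w (v - P *v v) = 0))"

definition reducible_on :: "complex ^ 'i ^ 'i \<Rightarrow> 'i set \<Rightarrow> bool"
  where "reducible_on A L \<longleftrightarrow>
    (\<exists>L1 L2. L = L1 \<union> L2 \<and> L1 \<inter> L2 = {} \<and> L1 \<noteq> {} \<and> L2 \<noteq> {} \<and>
       (\<forall>x\<in>L1. \<forall>y\<in>L2. A $ x $ y = 0))"

abbreviation irreducible_on :: "complex ^ 'i ^ 'i \<Rightarrow> 'i set \<Rightarrow> bool"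
  where "irreducible_on A L \<equiv> \<not> reducible_on A L"


section \<open>Fermionic Fock space\<close>

text \<open>
  Sites form a finite type \<open>'x\<close> and colors a finite linearly ordered type \<open>'n\<close>, so that the
  lattice is \<open>UNIV :: 'x set\<close> and \<open>N = CARD('n)\<close>.  A single-particle mode is a pair of a site and a
  color.  The Fock space has the occupation number basis indexed by sets of occupied modes, and a
  state is given by its coefficients in this basis.  For an occupied set \<open>S\<close>, the basis vector is
  the product of the creation operators of the modes in \<open>S\<close>, arranged in increasing order with
  respect to \<open>to_nat\<close>, applied to the vacuum; this fixes the signs below.  The choice of
  the mode order is immaterial: different orders give unitarily equivalent operators.
\<close>

type_synonym ('x, 'n) fock = "complex ^ (('x \<times> 'n) set)"

definition mode_sign :: "'m::countable \<Rightarrow> 'm set \<Rightarrow> complex"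
  where "mode_sign m S = (- 1) ^ card {k \<in> S. to_nat k < to_nat m}"

definition annih :: "'x::finite \<Rightarrow> 'n::finite \<Rightarrow> ('x, 'n) fock \<Rightarrow> ('x, 'n) fock"
  where "annih x \<alpha> \<Phi> =
    (\<chi> S. if (x, \<alpha>) \<in> S then 0 else mode_sign (x, \<alpha>) S * \<Phi> $ insert (x, \<alpha>) S)"

definition creat :: "'x::finite \<Rightarrow> 'n::finite \<Rightarrow> ('x, 'n) fock \<Rightarrow> ('x, 'n) fock"
  where "creat x \<alpha> \<Phi> =
    (\<chi> S. if (x, \<alpha>) \<in> S then mode_sign (x, \<alpha>) S * \<Phi> $ (S - {(x, \<alpha>)}) else 0)"

lemma mode_sign_insert:
  fixes m k :: "'m::{finite,countable}"
  assumes "k \<notin> S"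
  shows "mode_sign m (insert k S) = (if to_nat k < to_nat m then - mode_sign m S else mode_sign m S)"
proof (cases "to_nat k < to_nat m")
  case True
  then have "{l \<in> insert k S. to_nat l < to_nat m} = insert k {l \<in> S. to_nat l < to_nat m}"
    by auto
  then show ?thesis
    using True assms by (simp add: mode_sign_def)
next
  case False
  then have "{l \<in> insert k S. to_nat l < to_nat m} = {l \<in> S. to_nat l < to_nat m}"
    by auto
  then show ?thesis
    using False by (simp add: mode_sign_def)
qed

lemma mode_sign_remove:
  fixes m k :: "'m::{finite,countable}"
  assumes "k \<in> S"
  shows "mode_sign m (S - {k}) = (if to_nat k < to_nat m then - mode_sign m S else mode_sign m S)"
  using mode_sign_insert[of k "S - {k}" m] assms by (auto simp: insert_absorb)

lemma mode_sign_square: "mode_sign m S * (mode_sign m S * z) = z"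
  by (simp add: mode_sign_def flip: mult.assoc power_add)

lemma mode_order_total: "m \<noteq> k \<Longrightarrow> to_nat m < to_nat k \<longleftrightarrow> \<not> to_nat k < to_nat (m::'m::countable)"
  by (metis less_irrefl less_asym linorder_neqE_nat to_nat_split)

text \<open>The canonical anticommutation relations, and the mutual adjointness of \<open>creat\<close> and \<open>annih\<close>.\<close>

lemma annih_annih:
  "annih x \<alpha> (annih y \<beta> \<Phi>) + annih y \<beta> (annih x \<alpha> \<Phi>) = 0"
  using mode_order_total[of "(x, \<alpha>)" "(y, \<beta>)"]
  by (cases "(x, \<alpha>) = (y, \<beta>)")
     (auto simp: annih_def vec_eq_iff mode_sign_insert insert_commute)

lemma creat_creat:
  "creat x \<alpha> (creat y \<beta> \<Phi>) + creat y \<beta> (creat x \<alpha> \<Phi>) = 0"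
  using mode_order_total[of "(x, \<alpha>)" "(y, \<beta>)"]
  by (cases "(x, \<alpha>) = (y, \<beta>)")
     (auto simp: creat_def vec_eq_iff mode_sign_remove Diff_insert2[symmetric] insert_commute)

lemma annih_creat:
  "annih x \<alpha> (creat y \<beta> \<Phi>) + creat y \<beta> (annih x \<alpha> \<Phi>) =
    (if x = y \<and> \<alpha> = \<beta> then \<Phi> else 0)"
proof (cases "(x, \<alpha>) = (y, \<beta>)")
  case True
  then show ?thesis
    by (auto simp: annih_def creat_def vec_eq_iff mode_sign_insert mode_sign_remove
        mode_sign_square insert_absorb)
next
  case False
  then show ?thesis
    using mode_order_total[of "(x, \<alpha>)" "(y, \<beta>)"]
    by (auto simp: annih_def creat_def vec_eq_iff mode_sign_insert mode_sign_remove
        insert_Diff_if)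
qed

lemma cinner_creat: "cinner (creat x \<alpha> \<Phi>) \<Psi> = cinner \<Phi> (annih x \<alpha> \<Psi>)"
proof -
  let ?m = "(x, \<alpha>)"
  have "cinner (creat x \<alpha> \<Phi>) \<Psi> =
      (\<Sum>S | ?m \<in> S. cnj (mode_sign ?m S * \<Phi> $ (S - {?m})) * \<Psi> $ S)"
    unfolding cinner_def by (rule sum.mono_neutral_cong_right) (auto simp: creat_def)
  also have "\<dots> = (\<Sum>S | ?m \<notin> S. cnj (\<Phi> $ S) * (mode_sign ?m S * \<Psi> $ insert ?m S))"
    by (rule sum.reindex_bij_witness[of _ "insert ?m" "\<lambda>S. S - {?m}"])
       (auto simp: insert_absorb mode_sign_remove, simp add: mode_sign_def)
  also have "\<dots> = cinner \<Phi> (annih x \<alpha> \<Psi>)"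
    unfolding cinner_def by (rule sum.mono_neutral_cong_left) (auto simp: annih_def)
  finally show ?thesis .
qed


section \<open>The SU(N) Hubbard model\<close>

definition num_op :: "'x::finite \<Rightarrow> 'n::finite \<Rightarrow> ('x, 'n) fock \<Rightarrow> ('x, 'n) fock"
  where "num_op x \<alpha> \<Phi> = creat x \<alpha> (annih x \<alpha> \<Phi>)"

definition total_num :: "('x::finite, 'n::finite) fock \<Rightarrow> ('x, 'n) fock"
  where "total_num \<Phi> = (\<Sum>x\<in>UNIV. \<Sum>\<alpha>\<in>UNIV. num_op x \<alpha> \<Phi>)"

definition sector :: "nat \<Rightarrow> ('x::finite, 'n::finite) fock set"
  where "sector Nc = {\<Phi>. total_num \<Phi> = of_nat Nc *s \<Phi>}"

definition hubbard :: "complex ^ 'x ^ 'x \<Rightarrow> real \<Rightarrow>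
    ('x::finite, 'n::{finite,linorder}) fock \<Rightarrow> ('x, 'n) fock"
  where "hubbard T U \<Phi> =
    (\<Sum>\<alpha>\<in>UNIV. \<Sum>x\<in>UNIV. \<Sum>y\<in>UNIV. T $ x $ y *s creat x \<alpha> (annih y \<alpha> \<Phi>)) +
    of_real U *s (\<Sum>\<alpha>\<in>UNIV. \<Sum>\<beta> | \<alpha> < \<beta>. \<Sum>x\<in>UNIV. num_op x \<alpha> (num_op x \<beta> \<Phi>))"

definition color_op :: "'n \<Rightarrow> 'n \<Rightarrow> ('x::finite, 'n::finite) fock \<Rightarrow> ('x, 'n) fock"
  where "color_op \<alpha> \<beta> \<Phi> = (\<Sum>x\<in>UNIV. creat x \<alpha> (annih x \<beta> \<Phi>))"

definition casimir :: "('x::finite, 'n::finite) fock \<Rightarrow> ('x, 'n) fock"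
  where "casimir \<Phi> = (1 / 2) *s
    ((\<Sum>\<alpha>\<in>UNIV. \<Sum>\<beta>\<in>UNIV. color_op \<alpha> \<beta> (color_op \<beta> \<alpha> \<Phi>)) -
     (1 / of_nat CARD('n)) *s total_num (total_num \<Phi>))"

text \<open>Only real eigenvalues are considered: \<open>hubbard\<close> (for Hermitian \<open>T\<close>) and \<open>casimir\<close> are
  self-adjoint.\<close>

definition eigenvector_on ::
    "(complex ^ 'i) set \<Rightarrow> (complex ^ 'i \<Rightarrow> complex ^ 'i) \<Rightarrow> real \<Rightarrow> complex ^ 'i \<Rightarrow> bool"
  where "eigenvector_on V A E \<Phi> \<longleftrightarrow> \<Phi> \<in> V \<and> \<Phi> \<noteq> 0 \<and> A \<Phi> = of_real E *s \<Phi>"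

definition eigenvalues_on ::
    "(complex ^ 'i) set \<Rightarrow> (complex ^ 'i \<Rightarrow> complex ^ 'i) \<Rightarrow> real set"
  where "eigenvalues_on V A = {E. \<exists>\<Phi>. eigenvector_on V A E \<Phi>}"

definition ground_state :: "complex ^ 'x ^ 'x \<Rightarrow> real \<Rightarrow> nat \<Rightarrow>
    ('x::finite, 'n::{finite,linorder}) fock \<Rightarrow> bool"
  where "ground_state T U Nc \<Phi> \<longleftrightarrow>
    (\<exists>E. eigenvector_on (sector Nc) (hubbard T U) E \<Phi> \<and>
         (\<forall>E'\<in>eigenvalues_on (sector Nc) (hubbard T U :: ('x, 'n) fock \<Rightarrow> _). E \<le> E'))"

definition max_casimir :: "nat \<Rightarrow> nat \<Rightarrow> real"
  where "max_casimir N Nc = real Nc * (real N - 1) / 2 * (real Nc / real N + 1)"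

text \<open>
  The value \<open>max_casimir N Nc\<close> is required both to be the eigenvalue of the ground state and to be
  the greatest eigenvalue of the Casimir operator in the sector.  The type argument fixes the color
  type, which cannot be inferred from \<open>T\<close>.
\<close>

definition SUN_ferromagnetism ::
    "'n::{finite,linorder} itself \<Rightarrow> complex ^ 'x ^ 'x \<Rightarrow> real \<Rightarrow> nat \<Rightarrow> bool"
  where "SUN_ferromagnetism TYPE('n) T U Nc \<longleftrightarrow>
    (\<forall>\<Phi> :: ('x::finite, 'n) fock. ground_state T U Nc \<Phi> \<longrightarrow>
       casimir \<Phi> = of_real (max_casimir CARD('n) Nc) *s \<Phi> \<and>
       max_casimir CARD('n) Nc \<in> eigenvalues_on (sector Nc) (casimir :: ('x, 'n) fock \<Rightarrow> _) \<and>
       (\<forall>C\<in>eigenvalues_on (sector Nc) (casimir :: ('x, 'n) fock \<Rightarrow> _).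
          C \<le> max_casimir CARD('n) Nc))"

end

theory Submission
  imports Defs
begin

text \<open>
  Filling \<open>D0\<close> kernel modes with a single color gives energy \<open>0\<close>, and the Hamiltonian is
  nonnegative.  So the ground states are the states whose one-particle wave functions lie in
  \<open>ker T\<close> and in which no site is doubly occupied.  The Casimir operator equals its maximal value
  minus a sum of squares, so the maximum is attained exactly by the states on which the colors of
  any two annihilated particles may be exchanged.

  Choose a set \<open>I\<close> of \<open>D0\<close> sites and a basis \<open>\<mu>\<close> of \<open>ker T\<close> dual to the
  evaluations at \<open>I\<close>.  A ground state has exactly one particle on each site of \<open>I\<close>, and if
  \<open>\<mu> p\<close> and \<open>\<mu> q\<close> overlap at some site \<open>x\<close>, the absence of double occupation at
  \<open>x\<close> makes the colors at \<open>p\<close> and \<open>q\<close> exchangeable.  Exchangeability is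
  transitive, so it holds everywhere if the overlap graph on \<open>I\<close> is connected, which is
  irreducibility of the projection.  If the graph splits, filling the two parts with different colors
  gives a ground state which is not color symmetric.
\<close>

section \<open>The inner product\<close>

lemma cinner_add_right: "cinner u (v + w) = cinner u v + cinner u w"
  by (simp add: cinner_def algebra_simps sum.distrib)

lemma cinner_diff_right: "cinner u (v - w) = cinner u v - cinner u w"
  by (simp add: cinner_def algebra_simps sum_subtractf)

lemma cinner_scale_right: "cinner u (c *s v) = c * cinner u v"
  by (simp add: cinner_def sum_distrib_left mult.left_commute)

lemma cinner_zero_right [simp]: "cinner u 0 = 0"
  by (simp add: cinner_def)

lemma cinner_sum_right: "cinner u (\<Sum>i\<in>A. f i) = (\<Sum>i\<in>A. cinner u (f i))"
  by (induction A rule: infinite_finite_induct) (auto simp: cinner_add_right)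

lemma cinner_commute: "cinner v w = cnj (cinner w v)"
  by (simp add: cinner_def mult.commute)

lemma cinner_add_left: "cinner (u + v) w = cinner u w + cinner v w"
  by (simp add: cinner_def algebra_simps sum.distrib)

lemma cinner_diff_left: "cinner (u - v) w = cinner u w - cinner v w"
  by (simp add: cinner_def algebra_simps sum_subtractf)

lemma cinner_scale_left: "cinner (c *s u) v = cnj c * cinner u v"
  by (simp add: cinner_def sum_distrib_left mult.assoc)

lemma cinner_self: "cinner v v = of_real (\<Sum>i\<in>UNIV. (cmod (v $ i))\<^sup>2)"
  by (simp add: cinner_def mult.commute flip: complex_norm_square)

lemma cinner_self_nonneg: "0 \<le> Re (cinner v v)"
  by (simp add: cinner_self sum_nonneg)

lemma cinner_self_eq_0_iff: "Re (cinner v v) = 0 \<longleftrightarrow> v = 0"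
  by (auto simp: cinner_self sum_nonneg_eq_0_iff vec_eq_iff)

lemma cinner_axis: "cinner (axis x 1) v = v $ x"
proof -
  have "cinner (axis x 1) v = (\<Sum>i\<in>UNIV. if i = x then v $ i else 0)"
    unfolding cinner_def by (rule sum.cong) (auto simp: axis_def)
  then show ?thesis
    by simp
qed

lemma hermitian_cinner:
  assumes "hermitian A"
  shows "cinner v (A *v w) = cinner (A *v v) w"
proof -
  have A: "A $ i $ j = cnj (A $ j $ i)" for i j
    using assms unfolding hermitian_def by blast
  have "cinner v (A *v w) = (\<Sum>i\<in>UNIV. \<Sum>j\<in>UNIV. cnj (v $ i) * (A $ i $ j * w $ j))"
    by (simp add: cinner_def matrix_vector_mult_def sum_distrib_left)
  also have "\<dots> = (\<Sum>j\<in>UNIV. \<Sum>i\<in>UNIV. cnj (v $ i) * (cnj (A $ j $ i) * w $ j))"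
    unfolding A[symmetric] by (rule sum.swap)
  also have "\<dots> = cinner (A *v v) w"
    unfolding cinner_def matrix_vector_mult_def vec_lambda_beta cnj_sum sum_distrib_right
    by (intro sum.cong refl) simp
  finally show ?thesis .
qed

text \<open>The form at \<open>v - t w\<close>, where \<open>w = A *v v\<close> and \<open>t\<close>
  is real, is a quadratic polynomial in \<open>t\<close> whose constant term vanishes by hypothesis.
  If its linear coefficient, twice the squared norm of \<open>w\<close> with a minus sign, were
  nonzero, the form would be negative for small positive \<open>t\<close>.\<close>

lemma pos_semidef_null:
  assumes "pos_semidef A" and "Re (cinner v (A *v v)) = 0"
  shows "A *v v = 0"
proof -
  define w where "w = A *v v"
  define a where "a = Re (cinner w w)"
  define b where "b = Re (cinner w (A *v w))"
  have herm: "hermitian A"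
    using assms by (simp add: pos_semidef_def)
  have quad: "0 \<le> t * t * b - 2 * t * a" for t :: real
  proof -
    have "0 \<le> Re (cinner (v - of_real t *s w) (A *v (v - of_real t *s w)))"
      using assms by (simp add: pos_semidef_def)
    moreover have "cinner v (A *v w) = cinner w w"
      using herm by (simp add: hermitian_cinner w_def)
    ultimately show ?thesis
      using assms(2)
      by (simp add: matrix_vector_mult_diff_distrib vector_scalar_commute
          cinner_diff_left cinner_diff_right cinner_scale_left cinner_scale_right a_def b_def
          algebra_simps flip: w_def)
  qed
  have a0: "a \<ge> 0"
    by (simp add: a_def cinner_self_nonneg)
  have b0: "b \<ge> 0"
    using assms(1) by (simp add: b_def pos_semidef_def)
  have "a = 0"
  proof (rule ccontr)
    assume "a \<noteq> 0"
    then have "a > 0" using a0 by simp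
    \<comment> \<open>This choice gives \<open>t * b = a - t < 2 * a\<close>, against the quadratic
      inequality; the \<open>+ 1\<close> covers \<open>b = 0\<close>.\<close>
    define t where "t = a / (b + 1)"
    have t: "t > 0" using \<open>a > 0\<close> b0 by (simp add: t_def)
    then have "t * b \<ge> 2 * a"
      using quad[of t] by (simp add: mult.assoc flip: right_diff_distrib)
    moreover have "t * (b + 1) = a" using b0 by (simp add: t_def)
    ultimately show False using t \<open>a > 0\<close> by (simp add: algebra_simps)
  qed
  then show ?thesis
    by (simp add: a_def cinner_self_eq_0_iff w_def)
qed

section \<open>Operators on the Fock space\<close>

lemma annih_add: "annih x \<alpha> (\<Phi> + \<Psi>) = annih x \<alpha> \<Phi> + annih x \<alpha> \<Psi>"
  by (simp add: annih_def vec_eq_iff algebra_simps)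

lemma annih_diff: "annih x \<alpha> (\<Phi> - \<Psi>) = annih x \<alpha> \<Phi> - annih x \<alpha> \<Psi>"
  by (simp add: annih_def vec_eq_iff algebra_simps)

lemma annih_scale: "annih x \<alpha> (c *s \<Phi>) = c *s annih x \<alpha> \<Phi>"
  by (simp add: annih_def vec_eq_iff)

lemma annih_zero [simp]: "annih x \<alpha> 0 = 0"
  by (simp add: annih_def vec_eq_iff)

lemma annih_uminus: "annih x \<alpha> (- \<Phi>) = - annih x \<alpha> \<Phi>"
  by (simp add: annih_def vec_eq_iff)

lemma annih_sum: "annih x \<alpha> (\<Sum>i\<in>A. f i) = (\<Sum>i\<in>A. annih x \<alpha> (f i))"
  by (induction A rule: infinite_finite_induct) (auto simp: annih_add)

lemma creat_add: "creat x \<alpha> (\<Phi> + \<Psi>) = creat x \<alpha> \<Phi> + creat x \<alpha> \<Psi>"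
  by (simp add: creat_def vec_eq_iff algebra_simps)

lemma creat_diff: "creat x \<alpha> (\<Phi> - \<Psi>) = creat x \<alpha> \<Phi> - creat x \<alpha> \<Psi>"
  by (simp add: creat_def vec_eq_iff algebra_simps)

lemma creat_scale: "creat x \<alpha> (c *s \<Phi>) = c *s creat x \<alpha> \<Phi>"
  by (simp add: creat_def vec_eq_iff)

lemma creat_zero [simp]: "creat x \<alpha> 0 = 0"
  by (simp add: creat_def vec_eq_iff)

lemma creat_uminus: "creat x \<alpha> (- \<Phi>) = - creat x \<alpha> \<Phi>"
  by (simp add: creat_def vec_eq_iff)

lemma creat_sum: "creat x \<alpha> (\<Sum>i\<in>A. f i) = (\<Sum>i\<in>A. creat x \<alpha> (f i))"
  by (induction A rule: infinite_finite_induct) (auto simp: creat_add)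

lemma annih_anticommute: "annih x \<alpha> (annih y \<beta> \<Phi>) = - annih y \<beta> (annih x \<alpha> \<Phi>)"
  using annih_annih[of x \<alpha> y \<beta> \<Phi>] by (simp add: eq_neg_iff_add_eq_0)

lemma annih_twice [simp]: "annih x \<alpha> (annih x \<alpha> \<Phi>) = 0"
  by (auto simp: annih_def vec_eq_iff)

lemma annih_creat_eq:
  "annih x \<alpha> (creat y \<beta> \<Phi>) = (if x = y \<and> \<alpha> = \<beta> then \<Phi> else 0) - creat y \<beta> (annih x \<alpha> \<Phi>)"
  using annih_creat[of x \<alpha> y \<beta> \<Phi>] by (simp add: eq_diff_eq)

lemma cinner_annih: "cinner \<Phi> (creat x \<alpha> \<Psi>) = cinner (annih x \<alpha> \<Phi>) \<Psi>"
  by (metis cinner_commute cinner_creat)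

section \<open>Number operators and sectors\<close>

lemma num_op_nth: "num_op x \<alpha> \<Phi> $ S = (if (x, \<alpha>) \<in> S then \<Phi> $ S else 0)"
  by (auto simp: num_op_def creat_def annih_def insert_absorb mode_sign_remove mode_sign_square)

lemma total_num_nth: "total_num \<Phi> $ S = of_nat (card S) * \<Phi> $ S"
proof -
  have "total_num \<Phi> $ S = (\<Sum>m\<in>UNIV. if m \<in> S then \<Phi> $ S else 0)"
    by (simp add: total_num_def num_op_nth sum.cartesian_product case_prod_unfold)
  also have "\<dots> = of_nat (card S) * \<Phi> $ S"
    by (simp add: sum.If_cases)
  finally show ?thesis .
qed

text \<open>The number operator is diagonal in the occupation basis, so the eigenvalue equation
  becomes a condition on the support.\<close>

lemma sector_iff: "\<Phi> \<in> sector m \<longleftrightarrow> (\<forall>S. \<Phi> $ S \<noteq> 0 \<longrightarrow> card S = m)"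
  by (auto simp: sector_def vec_eq_iff total_num_nth)

lemma annih_in_sector: "\<Phi> \<in> sector (Suc m) \<Longrightarrow> annih x \<alpha> \<Phi> \<in> sector m"
  by (force simp: sector_iff annih_def)

lemma creat_in_sector: "\<Phi> \<in> sector m \<Longrightarrow> creat x \<alpha> \<Phi> \<in> sector (Suc m)"
  by (auto simp: sector_iff creat_def) (metis card_Suc_Diff1 finite)

lemma sector_diff: "\<Phi> \<in> sector m \<Longrightarrow> \<Psi> \<in> sector m \<Longrightarrow> \<Phi> - \<Psi> \<in> sector m"
  by (auto simp: sector_iff) metis

lemma sector_add: "\<Phi> \<in> sector m \<Longrightarrow> \<Psi> \<in> sector m \<Longrightarrow> \<Phi> + \<Psi> \<in> sector m"
  by (auto simp: sector_iff) (metis add_0)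

lemma zero_in_sector [simp]: "0 \<in> sector m"
  by (simp add: sector_iff)

lemma sector_sum: "(\<And>i. i \<in> A \<Longrightarrow> f i \<in> sector m) \<Longrightarrow> (\<Sum>i\<in>A. f i) \<in> sector m"
  by (induction A rule: infinite_finite_induct) (auto intro: sector_add)

lemma sector_scale: "\<Phi> \<in> sector m \<Longrightarrow> c *s \<Phi> \<in> sector m"
  by (auto simp: sector_iff)

text \<open>The number operator rebuilds \<open>m\<close> times the state from its annihilated
  states; \<open>m > 0\<close> excludes the vacuum. This is the basic way to show that a state
  vanishes.\<close>

lemma sector_eq_0:
  assumes "\<Phi> \<in> sector m" "m > 0" "\<And>x \<alpha>. annih x \<alpha> \<Phi> = 0"
  shows "\<Phi> = 0"
proof -
  have "of_nat m *s \<Phi> = 0"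
    using assms(1,3) by (auto simp: sector_def total_num_def num_op_def)
  then show ?thesis
    using assms(2) by (auto simp: vec_eq_iff)
qed

section \<open>The Casimir operator\<close>

definition pair_antisym ::
    "'x \<Rightarrow> 'x \<Rightarrow> 'n \<Rightarrow> 'n \<Rightarrow> ('x::finite, 'n::finite) fock \<Rightarrow> ('x, 'n) fock"
  where "pair_antisym x y \<alpha> \<beta> \<Phi> = annih y \<beta> (annih x \<alpha> \<Phi>) - annih y \<alpha> (annih x \<beta> \<Phi>)"

text \<open>On a sector this is four times the amount by which \<open>casimir\<close> falls short of
  its maximum. The outer creation operators form the adjoint of \<open>pair_antisym\<close>, so the
  expectation value is a sum of squared norms.\<close>

definition pair_defect :: "('x::finite, 'n::finite) fock \<Rightarrow> ('x, 'n) fock"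
  where "pair_defect \<Phi> = (\<Sum>x\<in>UNIV. \<Sum>y\<in>UNIV. \<Sum>\<alpha>\<in>UNIV. \<Sum>\<beta>\<in>UNIV.
    creat x \<alpha> (creat y \<beta> (pair_antisym x y \<alpha> \<beta> \<Phi>)) -
    creat x \<beta> (creat y \<alpha> (pair_antisym x y \<alpha> \<beta> \<Phi>)))"

text \<open>\<open>pair_antisym\<close> changes sign when its colors are exchanged, so after
  relabelling both halves of the summand contribute equally. The two normal ordered sums that remain
  also occur in the squared number operator and in the products of color operators.\<close>

lemma pair_defect_expand:
  fixes \<Phi> :: "('x::finite, 'n::finite) fock"
  shows "pair_defect \<Phi> = 2 *s ((\<Sum>x\<in>UNIV. \<Sum>y\<in>UNIV. \<Sum>\<alpha>\<in>UNIV. \<Sum>\<beta>\<in>UNIV.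
      creat x \<alpha> (creat y \<beta> (annih y \<beta> (annih x \<alpha> \<Phi>)))) -
    (\<Sum>x\<in>UNIV. \<Sum>y\<in>UNIV. \<Sum>\<alpha>\<in>UNIV. \<Sum>\<beta>\<in>UNIV.
      creat x \<alpha> (creat y \<beta> (annih y \<alpha> (annih x \<beta> \<Phi>)))))"
proof -
  let ?f = "\<lambda>x y \<alpha> \<beta>. creat x \<alpha> (creat y \<beta> (pair_antisym x y \<alpha> \<beta> \<Phi>))"
  have "creat x \<beta> (creat y \<alpha> (pair_antisym x y \<alpha> \<beta> \<Phi>)) = - ?f x y \<beta> \<alpha>" for x y \<alpha> \<beta>
    by (simp add: pair_antisym_def creat_diff)
  then have "(\<Sum>\<alpha>\<in>UNIV. \<Sum>\<beta>\<in>UNIV. creat x \<beta> (creat y \<alpha> (pair_antisym x y \<alpha> \<beta> \<Phi>))) =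
      - (\<Sum>\<alpha>\<in>UNIV. \<Sum>\<beta>\<in>UNIV. ?f x y \<alpha> \<beta>)" for x y
    by (simp only: sum_negf) (subst sum.swap, rule refl)
  then have "pair_defect \<Phi> = (\<Sum>x\<in>UNIV. \<Sum>y\<in>UNIV. \<Sum>\<alpha>\<in>UNIV. \<Sum>\<beta>\<in>UNIV. ?f x y \<alpha> \<beta>) +
      (\<Sum>x\<in>UNIV. \<Sum>y\<in>UNIV. \<Sum>\<alpha>\<in>UNIV. \<Sum>\<beta>\<in>UNIV. ?f x y \<alpha> \<beta>)"
    by (simp only: pair_defect_def sum_subtractf sum_negf diff_minus_eq_add sum.distrib)
  also have "\<dots> = 2 *s (\<Sum>x\<in>UNIV. \<Sum>y\<in>UNIV. \<Sum>\<alpha>\<in>UNIV. \<Sum>\<beta>\<in>UNIV. ?f x y \<alpha> \<beta>)"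
    by (simp only: vec_eq_iff vector_add_component vector_smult_component mult_2 simp_thms)
  finally show ?thesis
    by (simp only: pair_antisym_def creat_diff sum_subtractf)
qed

text \<open>Normal ordering: moving \<open>creat y \<beta>\<close> to the left of
  \<open>annih x \<alpha>\<close> leaves a contraction only for equal modes, and the contractions
  add up to \<open>total_num \<Phi>\<close>.\<close>

lemma total_num_twice:
  "total_num (total_num \<Phi>) = total_num \<Phi> +
    (\<Sum>x\<in>UNIV. \<Sum>y\<in>UNIV. \<Sum>\<alpha>\<in>UNIV. \<Sum>\<beta>\<in>UNIV.
      creat x \<alpha> (creat y \<beta> (annih y \<beta> (annih x \<alpha> \<Phi>))))"
proof -
  have "creat x \<alpha> (annih x \<alpha> (creat y \<beta> (annih y \<beta> \<Phi>))) =
      (if x = y then if \<alpha> = \<beta> then creat x \<alpha> (annih x \<alpha> \<Phi>) else 0 else 0) +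
      creat x \<alpha> (creat y \<beta> (annih y \<beta> (annih x \<alpha> \<Phi>)))" for x y \<alpha> \<beta>
    by (auto simp: annih_creat_eq creat_add creat_diff creat_uminus annih_anticommute[of x \<alpha> y \<beta>])
  then have "total_num (total_num \<Phi>) = (\<Sum>x\<in>UNIV. \<Sum>\<alpha>\<in>UNIV. \<Sum>y\<in>UNIV. \<Sum>\<beta>\<in>UNIV.
      (if x = y then if \<alpha> = \<beta> then creat x \<alpha> (annih x \<alpha> \<Phi>) else 0 else 0) +
      creat x \<alpha> (creat y \<beta> (annih y \<beta> (annih x \<alpha> \<Phi>))))"
    by (simp add: total_num_def num_op_def annih_sum creat_sum)
  also have "\<dots> = (\<Sum>x\<in>UNIV. \<Sum>\<alpha>\<in>UNIV. \<Sum>y\<in>UNIV. if x = y then creat x \<alpha> (annih x \<alpha> \<Phi>) else 0) +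
      (\<Sum>x\<in>UNIV. \<Sum>\<alpha>\<in>UNIV. \<Sum>y\<in>UNIV. \<Sum>\<beta>\<in>UNIV.
      creat x \<alpha> (creat y \<beta> (annih y \<beta> (annih x \<alpha> \<Phi>))))"
  proof -
    have "(\<Sum>\<beta>\<in>UNIV. if x = y then if \<alpha> = \<beta> then creat x \<alpha> (annih x \<alpha> \<Phi>) else 0 else 0) =
        (if x = y then creat x \<alpha> (annih x \<alpha> \<Phi>) else 0)" for x y \<alpha>
      by simp
    then show ?thesis
      by (simp only: sum.distrib)
  qed
  also have "(\<Sum>x\<in>UNIV. \<Sum>\<alpha>\<in>UNIV. \<Sum>y\<in>UNIV. if x = y then creat x \<alpha> (annih x \<alpha> \<Phi>) else 0) = total_num \<Phi>"
    by (simp add: total_num_def num_op_def)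
  also have "(\<Sum>x\<in>UNIV. \<Sum>\<alpha>\<in>UNIV. \<Sum>y\<in>UNIV. \<Sum>\<beta>\<in>UNIV.
      creat x \<alpha> (creat y \<beta> (annih y \<beta> (annih x \<alpha> \<Phi>)))) =
      (\<Sum>x\<in>UNIV. \<Sum>y\<in>UNIV. \<Sum>\<alpha>\<in>UNIV. \<Sum>\<beta>\<in>UNIV.
      creat x \<alpha> (creat y \<beta> (annih y \<beta> (annih x \<alpha> \<Phi>))))"
    by (intro sum.cong refl sum.swap)
  finally show ?thesis .
qed

lemma sum_swap_pairs:
  fixes f :: "'a \<Rightarrow> 'b \<Rightarrow> 'c \<Rightarrow> 'd \<Rightarrow> 'e::comm_monoid_add"
  shows "(\<Sum>a\<in>A. \<Sum>b\<in>B. \<Sum>c\<in>C. \<Sum>d\<in>D. f a b c d) =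
    (\<Sum>c\<in>C. \<Sum>d\<in>D. \<Sum>a\<in>A. \<Sum>b\<in>B. f a b c d)"
proof -
  have swap: "(\<Sum>b\<in>B. \<Sum>c\<in>C. \<Sum>d\<in>D. g b c d) = (\<Sum>c\<in>C. \<Sum>d\<in>D. \<Sum>b\<in>B. g b c d)"
    for g :: "'z \<Rightarrow> 'c \<Rightarrow> 'd \<Rightarrow> 'e" and B
    by (subst sum.swap, rule sum.cong[OF refl], rule sum.swap)
  show ?thesis
    unfolding swap[of _ B] by (rule swap)
qed

text \<open>Normal ordering again. Both contracted operators carry the color \<beta>, so a
  contraction needs only equal sites, and the free sum over \<beta> gives the factor
  \<open>CARD('n)\<close>.\<close>

lemma color_ops_sum:
  fixes \<Phi> :: "('x::finite, 'n::finite) fock"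
  shows "(\<Sum>\<alpha>\<in>UNIV. \<Sum>\<beta>\<in>UNIV. color_op \<alpha> \<beta> (color_op \<beta> \<alpha> \<Phi>)) =
    of_nat CARD('n) *s total_num \<Phi> +
    (\<Sum>x\<in>UNIV. \<Sum>y\<in>UNIV. \<Sum>\<alpha>\<in>UNIV. \<Sum>\<beta>\<in>UNIV.
      creat x \<alpha> (creat y \<beta> (annih y \<alpha> (annih x \<beta> \<Phi>))))"
proof -
  have "creat x \<alpha> (annih x \<beta> (creat y \<beta> (annih y \<alpha> \<Phi>))) =
      (if x = y then creat x \<alpha> (annih x \<alpha> \<Phi>) else 0) +
      creat x \<alpha> (creat y \<beta> (annih y \<alpha> (annih x \<beta> \<Phi>)))" for x y \<alpha> \<beta>
    by (auto simp: annih_creat_eq creat_add creat_diff creat_uminus annih_anticommute[of x \<beta> y \<alpha>])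
  then have "(\<Sum>\<alpha>\<in>UNIV. \<Sum>\<beta>\<in>UNIV. color_op \<alpha> \<beta> (color_op \<beta> \<alpha> \<Phi>)) =
     (\<Sum>\<alpha>\<in>UNIV. \<Sum>\<beta>\<in>UNIV. \<Sum>x\<in>UNIV. \<Sum>y\<in>UNIV. (if x = y then creat x \<alpha> (annih x \<alpha> \<Phi>) else 0) +
      creat x \<alpha> (creat y \<beta> (annih y \<alpha> (annih x \<beta> \<Phi>))))"
    by (simp add: color_op_def annih_sum creat_sum)
  also have "\<dots> = (\<Sum>\<alpha>\<in>UNIV. \<Sum>\<beta>\<in>(UNIV::'n set). \<Sum>x\<in>UNIV. creat x \<alpha> (annih x \<alpha> \<Phi>)) +
     (\<Sum>\<alpha>\<in>UNIV. \<Sum>\<beta>\<in>UNIV. \<Sum>x\<in>UNIV. \<Sum>y\<in>UNIV. creat x \<alpha> (creat y \<beta> (annih y \<alpha> (annih x \<beta> \<Phi>))))"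
    by (simp add: sum.distrib)
  also have "(\<Sum>\<alpha>\<in>UNIV. \<Sum>\<beta>\<in>(UNIV::'n set). \<Sum>x\<in>UNIV. creat x \<alpha> (annih x \<alpha> \<Phi>)) =
      of_nat CARD('n) *s total_num \<Phi>"
  proof -
    have "(\<Sum>\<beta>\<in>A. \<Psi>) = of_nat (card A) *s \<Psi>" if "finite A" for \<Psi> :: "('x, 'n) fock" and A :: "'n set"
      using that by induction (simp_all add: vec.scale_left_distrib del: sum_constant)
    then show ?thesis
      unfolding total_num_def num_op_def
      by (subst sum.swap[of _ UNIV "UNIV :: 'x set"]) (simp only: vec.scale_sum_right finite)
  qed
  also have "(\<Sum>\<alpha>\<in>UNIV. \<Sum>\<beta>\<in>UNIV. \<Sum>x\<in>UNIV. \<Sum>y\<in>UNIV.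
        creat x \<alpha> (creat y \<beta> (annih y \<alpha> (annih x \<beta> \<Phi>)))) =
      (\<Sum>x\<in>UNIV. \<Sum>y\<in>UNIV. \<Sum>\<alpha>\<in>UNIV. \<Sum>\<beta>\<in>UNIV.
        creat x \<alpha> (creat y \<beta> (annih y \<alpha> (annih x \<beta> \<Phi>))))"
    by (rule sum_swap_pairs)
  finally show ?thesis .
qed

text \<open>The three preceding expansions eliminate both normal ordered sums. With
  \<open>N = CARD('n)\<close>, the scalar left over on the sector is
  \<open>(m^2 - m + N * m - m^2 / N) / 2\<close>, which is the maximal value.\<close>

lemma casimir_eq:
  fixes \<Phi> :: "('x::finite, 'n::finite) fock"
  assumes "\<Phi> \<in> sector m"
  shows "casimir \<Phi> = of_real (max_casimir CARD('n) m) *s \<Phi> - (1 / 4) *s pair_defect \<Phi>"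
proof -
  define X where "X = (\<Sum>\<alpha>\<in>UNIV. \<Sum>\<beta>\<in>UNIV. color_op \<alpha> \<beta> (color_op \<beta> \<alpha> \<Phi>))"
  have t: "total_num \<Phi> = of_nat m *s \<Phi>"
    using assms by (simp add: sector_def)
  have tt: "total_num (of_nat m *s \<Phi>) = of_nat m *s (of_nat m *s \<Phi>)"
    using sector_scale[OF assms] by (simp add: sector_def)
  have "pair_defect \<Phi> =
      2 *s ((total_num (total_num \<Phi>) - total_num \<Phi>) - (X - of_nat CARD('n) *s total_num \<Phi>))"
    unfolding pair_defect_expand X_def by (simp add: total_num_twice[of \<Phi>] color_ops_sum)
  then have X: "X = of_nat m *s (of_nat m *s \<Phi>) - of_nat m *s \<Phi> +
      of_nat CARD('n) *s (of_nat m *s \<Phi>) - (1 / 2) *s pair_defect \<Phi>"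
    by (simp add: t tt vec_eq_iff field_simps)
  then show ?thesis
    unfolding casimir_def t tt max_casimir_def X_def[symmetric]
    by (simp add: X vec_eq_iff field_simps)
qed

lemma cinner_pair_defect:
  "cinner \<Phi> (pair_defect \<Phi>) = (\<Sum>x\<in>UNIV. \<Sum>y\<in>UNIV. \<Sum>\<alpha>\<in>UNIV. \<Sum>\<beta>\<in>UNIV.
    cinner (pair_antisym x y \<alpha> \<beta> \<Phi>) (pair_antisym x y \<alpha> \<beta> \<Phi>))"
proof -
  have "cinner \<Phi> (creat x \<alpha> (creat y \<beta> \<Psi>) - creat x \<beta> (creat y \<alpha> \<Psi>)) =
      cinner (pair_antisym x y \<alpha> \<beta> \<Phi>) \<Psi>" for x y \<alpha> \<beta> \<Psi>
    by (simp add: cinner_diff_right cinner_annih pair_antisym_def cinner_diff_left)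
  then show ?thesis
    by (simp add: pair_defect_def cinner_sum_right)
qed

lemma cinner_pair_defect_nonneg: "0 \<le> Re (cinner \<Phi> (pair_defect \<Phi>))"
  by (simp add: cinner_pair_defect sum_nonneg cinner_self_nonneg)

lemma pair_defect_eq_0_iff: "pair_defect \<Phi> = 0 \<longleftrightarrow> (\<forall>x y \<alpha> \<beta>. pair_antisym x y \<alpha> \<beta> \<Phi> = 0)"
proof
  assume "pair_defect \<Phi> = 0"
  then have "Re (cinner \<Phi> (pair_defect \<Phi>)) = 0"
    by simp
  then show "\<forall>x y \<alpha> \<beta>. pair_antisym x y \<alpha> \<beta> \<Phi> = 0"
    by (simp add: cinner_pair_defect sum_nonneg cinner_self_nonneg sum_nonneg_eq_0_iff
        cinner_self_eq_0_iff)
qed (simp add: pair_defect_def)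

lemma casimir_max_iff:
  fixes \<Phi> :: "('x::finite, 'n::finite) fock"
  assumes "\<Phi> \<in> sector m"
  shows "casimir \<Phi> = of_real (max_casimir CARD('n) m) *s \<Phi> \<longleftrightarrow>
    (\<forall>x y \<alpha> \<beta>. annih y \<beta> (annih x \<alpha> \<Phi>) = annih y \<alpha> (annih x \<beta> \<Phi>))"
proof -
  have "casimir \<Phi> = of_real (max_casimir CARD('n) m) *s \<Phi> \<longleftrightarrow> pair_defect \<Phi> = 0"
    by (simp add: casimir_eq[OF assms])
  then show ?thesis
    by (simp add: pair_defect_eq_0_iff pair_antisym_def)
qed

lemma casimir_le_max:
  assumes "C \<in> eigenvalues_on (sector m) (casimir :: ('x::finite, 'n::finite) fock \<Rightarrow> _)"
  shows "C \<le> max_casimir CARD('n) m"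
proof -
  obtain \<Phi> :: "('x, 'n) fock" where
    \<Phi>: "\<Phi> \<in> sector m" "\<Phi> \<noteq> 0" "casimir \<Phi> = of_real C *s \<Phi>"
    using assms by (auto simp: eigenvalues_on_def eigenvector_on_def)
  have "of_real C *s \<Phi> = of_real (max_casimir CARD('n) m) *s \<Phi> - (1 / 4) *s pair_defect \<Phi>"
    using casimir_eq[OF \<Phi>(1)] \<Phi>(3) by simp
  then have "Re (cinner \<Phi> (of_real C *s \<Phi>)) =
      Re (cinner \<Phi> (of_real (max_casimir CARD('n) m) *s \<Phi> - (1 / 4) *s pair_defect \<Phi>))"
    by simp
  then have "C * Re (cinner \<Phi> \<Phi>) \<le> max_casimir CARD('n) m * Re (cinner \<Phi> \<Phi>)"
    using cinner_pair_defect_nonneg[of \<Phi>] by (simp add: cinner_diff_right cinner_scale_right)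
  moreover have "0 < Re (cinner \<Phi> \<Phi>)"
    using \<Phi>(2) cinner_self_nonneg[of \<Phi>] cinner_self_eq_0_iff[of \<Phi>] by linarith
  ultimately show ?thesis
    by simp
qed

section \<open>Zero-energy states\<close>

text \<open>The \<open>S\<close>-component of \<open>annih x \<alpha> \<Phi>\<close>, as a function of the site \<open>x\<close>, is a single-particle
  wave function; the hopping energy is the sum of the energies of these.\<close>

definition wave :: "'n \<Rightarrow> ('x \<times> 'n) set \<Rightarrow> ('x::finite, 'n::finite) fock \<Rightarrow> complex ^ 'x"
  where "wave \<alpha> S \<Phi> = (\<chi> x. annih x \<alpha> \<Phi> $ S)"

text \<open>Different colors leave no contraction, and the two signs from anticommuting cancel. In
  this order the expectation value is a squared norm.\<close>

lemma num_op_num_op: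
  assumes "\<alpha> \<noteq> \<beta>"
  shows "num_op x \<alpha> (num_op x \<beta> \<Phi>) = creat x \<alpha> (creat x \<beta> (annih x \<beta> (annih x \<alpha> \<Phi>)))"
  using assms
  by (simp add: num_op_def annih_creat_eq creat_uminus annih_anticommute[of x \<alpha> x \<beta>])

lemma cinner_hopping:
  "cinner \<Phi> (\<Sum>x\<in>UNIV. \<Sum>y\<in>UNIV. T $ x $ y *s creat x \<alpha> (annih y \<alpha> \<Phi>)) =
    (\<Sum>S\<in>UNIV. cinner (wave \<alpha> S \<Phi>) (T *v wave \<alpha> S \<Phi>))"
proof -
  have "cinner \<Phi> (\<Sum>x\<in>UNIV. \<Sum>y\<in>UNIV. T $ x $ y *s creat x \<alpha> (annih y \<alpha> \<Phi>)) =
      (\<Sum>x\<in>UNIV. \<Sum>y\<in>UNIV. T $ x $ y * cinner (annih x \<alpha> \<Phi>) (annih y \<alpha> \<Phi>))"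
    by (simp add: cinner_sum_right cinner_scale_right cinner_annih)
  also have "\<dots> = (\<Sum>x\<in>UNIV. \<Sum>y\<in>UNIV. \<Sum>S\<in>UNIV.
      cnj (wave \<alpha> S \<Phi> $ x) * (T $ x $ y * wave \<alpha> S \<Phi> $ y))"
    unfolding cinner_def wave_def vec_lambda_beta sum_distrib_left
    by (intro sum.cong refl) simp
  also have "\<dots> = (\<Sum>x\<in>UNIV. \<Sum>S\<in>UNIV. \<Sum>y\<in>UNIV.
      cnj (wave \<alpha> S \<Phi> $ x) * (T $ x $ y * wave \<alpha> S \<Phi> $ y))"
    by (intro sum.cong refl sum.swap)
  also have "\<dots> = (\<Sum>S\<in>UNIV. \<Sum>x\<in>UNIV. \<Sum>y\<in>UNIV.
      cnj (wave \<alpha> S \<Phi> $ x) * (T $ x $ y * wave \<alpha> S \<Phi> $ y))"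
    by (rule sum.swap)
  also have "\<dots> = (\<Sum>S\<in>UNIV. cinner (wave \<alpha> S \<Phi>) (T *v wave \<alpha> S \<Phi>))"
    unfolding cinner_def matrix_vector_mult_def vec_lambda_beta sum_distrib_left ..
  finally show ?thesis .
qed

lemma cinner_hubbard:
  "cinner \<Phi> (hubbard T U \<Phi>) =
    (\<Sum>\<alpha>\<in>UNIV. \<Sum>S\<in>UNIV. cinner (wave \<alpha> S \<Phi>) (T *v wave \<alpha> S \<Phi>)) +
    of_real U * (\<Sum>\<alpha>\<in>UNIV. \<Sum>\<beta> | \<alpha> < \<beta>. \<Sum>x\<in>UNIV.
      cinner (annih x \<beta> (annih x \<alpha> \<Phi>)) (annih x \<beta> (annih x \<alpha> \<Phi>)))"
proof -
  have "cinner \<Phi> (num_op x \<alpha> (num_op x \<beta> \<Phi>)) =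
      cinner (annih x \<beta> (annih x \<alpha> \<Phi>)) (annih x \<beta> (annih x \<alpha> \<Phi>))"
    if "\<beta> \<in> {\<beta>. \<alpha> < \<beta>}" for x \<alpha> \<beta>
    using that by (simp add: num_op_num_op cinner_annih)
  then have "cinner \<Phi> (\<Sum>\<alpha>\<in>UNIV. \<Sum>\<beta> | \<alpha> < \<beta>. \<Sum>x\<in>UNIV. num_op x \<alpha> (num_op x \<beta> \<Phi>)) =
      (\<Sum>\<alpha>\<in>UNIV. \<Sum>\<beta> | \<alpha> < \<beta>. \<Sum>x\<in>UNIV.
        cinner (annih x \<beta> (annih x \<alpha> \<Phi>)) (annih x \<beta> (annih x \<alpha> \<Phi>)))"
    by (simp add: cinner_sum_right)
  moreover have "cinner \<Phi> (\<Sum>\<alpha>\<in>UNIV. \<Sum>x\<in>UNIV. \<Sum>y\<in>UNIV. T $ x $ y *s creat x \<alpha> (annih y \<alpha> \<Phi>)) =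
      (\<Sum>\<alpha>\<in>UNIV. \<Sum>S\<in>UNIV. cinner (wave \<alpha> S \<Phi>) (T *v wave \<alpha> S \<Phi>))"
    by (subst cinner_sum_right) (simp only: cinner_hopping)
  ultimately show ?thesis
    by (simp only: hubbard_def cinner_add_right cinner_scale_right)
qed

text \<open>The energy is a sum of nonnegative hopping and interaction terms, so at zero energy
  every term vanishes, and \<open>pos_semidef_null\<close> puts the wave functions into the kernel.
  Conversely, these conditions annihilate the hopping and the interaction operator
  separately.\<close>

lemma
  fixes \<Phi> :: "('x::finite, 'n::{finite,linorder}) fock"
  assumes "pos_semidef T" and "U > 0"
  shows hubbard_nonneg: "0 \<le> Re (cinner \<Phi> (hubbard T U \<Phi>))"
    and hubbard_eq_0_iff: "hubbard T U \<Phi> = 0 \<longleftrightarrow>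
      (\<forall>\<alpha> S. wave \<alpha> S \<Phi> \<in> mat_kernel T) \<and> (\<forall>x \<alpha> \<beta>. annih x \<beta> (annih x \<alpha> \<Phi>) = 0)"
proof -
  define K where "K = (\<Sum>\<alpha>\<in>UNIV. \<Sum>S\<in>UNIV. Re (cinner (wave \<alpha> S \<Phi>) (T *v wave \<alpha> S \<Phi>)))"
  define V where "V = (\<Sum>\<alpha>\<in>UNIV. \<Sum>\<beta> | \<alpha> < \<beta>. \<Sum>x\<in>UNIV.
      Re (cinner (annih x \<beta> (annih x \<alpha> \<Phi>)) (annih x \<beta> (annih x \<alpha> \<Phi>))))"
  have H: "Re (cinner \<Phi> (hubbard T U \<Phi>)) = K + U * V"
    by (simp add: cinner_hubbard K_def V_def)
  have K_term: "0 \<le> Re (cinner v (T *v v))" for v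
    using assms by (simp add: pos_semidef_def)
  have K: "K \<ge> 0"
    by (simp add: K_def sum_nonneg K_term)
  have V: "V \<ge> 0"
    by (simp add: V_def sum_nonneg cinner_self_nonneg)
  show "0 \<le> Re (cinner \<Phi> (hubbard T U \<Phi>))"
    unfolding H using K V assms by simp
  show "hubbard T U \<Phi> = 0 \<longleftrightarrow>
      (\<forall>\<alpha> S. wave \<alpha> S \<Phi> \<in> mat_kernel T) \<and> (\<forall>x \<alpha> \<beta>. annih x \<beta> (annih x \<alpha> \<Phi>) = 0)"
  proof (intro iffI conjI allI)
    assume "hubbard T U \<Phi> = 0"
    then have "K + U * V = 0"
      using H by simp
    moreover have "U * V \<ge> 0"
      using V assms by simp
    ultimately have "K = 0" "U * V = 0"
      using K by linarith+
    then have "V = 0"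
      using assms by simp
    {
      fix \<alpha> S
      have "Re (cinner (wave \<alpha> S \<Phi>) (T *v wave \<alpha> S \<Phi>)) = 0"
        using \<open>K = 0\<close> by (simp add: K_def sum_nonneg K_term sum_nonneg_eq_0_iff)
      then show "wave \<alpha> S \<Phi> \<in> mat_kernel T"
        unfolding mat_kernel_def using assms pos_semidef_null by blast
    }
    fix x and \<alpha> \<beta> :: 'n
    have less: "annih x \<beta> (annih x \<alpha> \<Phi>) = 0" if "\<alpha> < \<beta>" for \<alpha> \<beta>
      using \<open>V = 0\<close> that
      by (auto simp: V_def sum_nonneg cinner_self_nonneg sum_nonneg_eq_0_iff cinner_self_eq_0_iff)
    \<comment> \<open>The interaction sum covers only \<alpha> < \<beta>; the reversed pairs follow
      by anticommutation and equal colors by the Pauli principle.\<close>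
    consider "\<alpha> < \<beta>" | "\<beta> < \<alpha>" | "\<alpha> = \<beta>"
      by fastforce
    then show "annih x \<beta> (annih x \<alpha> \<Phi>) = 0"
    proof cases
      case 2
      then show ?thesis
        using less annih_anticommute[of x \<beta> x \<alpha> \<Phi>] by simp
    qed (simp_all add: less)
  next
    assume *: "(\<forall>\<alpha> S. wave \<alpha> S \<Phi> \<in> mat_kernel T) \<and> (\<forall>x \<alpha> \<beta>. annih x \<beta> (annih x \<alpha> \<Phi>) = 0)"
    have "(\<Sum>y\<in>UNIV. T $ x $ y *s annih y \<alpha> \<Phi>) $ S = (T *v wave \<alpha> S \<Phi>) $ x" for x \<alpha> S
      by (simp add: wave_def matrix_vector_mult_def)
    then have "(\<Sum>y\<in>UNIV. T $ x $ y *s annih y \<alpha> \<Phi>) = 0" for x \<alpha>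
      using * by (simp add: mat_kernel_def vec_eq_iff)
    moreover have "(\<Sum>y\<in>UNIV. T $ x $ y *s creat x \<alpha> (annih y \<alpha> \<Phi>)) =
        creat x \<alpha> (\<Sum>y\<in>UNIV. T $ x $ y *s annih y \<alpha> \<Phi>)" for x \<alpha>
      by (simp add: creat_sum creat_scale)
    moreover have "num_op x \<alpha> (num_op x \<beta> \<Phi>) = 0" if "\<alpha> < \<beta>" for x \<alpha> \<beta>
      using that * by (simp add: num_op_num_op)
    ultimately show "hubbard T U \<Phi> = 0"
      by (simp add: hubbard_def)
  qed
qed

text \<open>The given zero-energy state \<open>\<Phi>0\<close> pins the lowest eigenvalue in the
  sector to 0, since no eigenvalue is negative.\<close>

lemma ground_state_iff_zero_energy:
  fixes T :: "complex ^ 'x::finite ^ 'x" and \<Phi>0 \<Phi> :: "('x, 'n::{finite,linorder}) fock"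
  assumes "pos_semidef T" "U > 0" and \<Phi>0: "\<Phi>0 \<in> sector m" "\<Phi>0 \<noteq> 0" "hubbard T U \<Phi>0 = 0"
  shows "ground_state T U m \<Phi> \<longleftrightarrow> \<Phi> \<in> sector m \<and> \<Phi> \<noteq> 0 \<and> hubbard T U \<Phi> = 0"
proof -
  have pos: "0 \<le> E" if "E \<in> eigenvalues_on (sector m) (hubbard T U :: ('x, 'n) fock \<Rightarrow> _)" for E
  proof -
    obtain \<Psi> :: "('x, 'n) fock" where \<Psi>: "\<Psi> \<noteq> 0" "hubbard T U \<Psi> = of_real E *s \<Psi>"
      using \<open>E \<in> _\<close> by (auto simp: eigenvalues_on_def eigenvector_on_def)
    have "0 \<le> E * Re (cinner \<Psi> \<Psi>)"
      using hubbard_nonneg[OF assms(1,2), of \<Psi>] \<Psi>(2) by (simp add: cinner_scale_right)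
    moreover have "0 < Re (cinner \<Psi> \<Psi>)"
      using \<Psi>(1) cinner_self_nonneg[of \<Psi>] cinner_self_eq_0_iff[of \<Psi>] by linarith
    ultimately show ?thesis
      by (simp add: zero_le_mult_iff)
  qed
  have zero: "0 \<in> eigenvalues_on (sector m) (hubbard T U :: ('x, 'n) fock \<Rightarrow> _)"
    using \<Phi>0 by (auto simp: eigenvalues_on_def eigenvector_on_def)
  show ?thesis
  proof
    assume "ground_state T U m \<Phi>"
    then obtain E where E: "eigenvector_on (sector m) (hubbard T U) E \<Phi>"
        "\<forall>E'\<in>eigenvalues_on (sector m) (hubbard T U :: ('x, 'n) fock \<Rightarrow> _). E \<le> E'"
      by (auto simp: ground_state_def)
    have "E = 0"
      using E zero pos[of E] by (fastforce simp: eigenvalues_on_def)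
    then show "\<Phi> \<in> sector m \<and> \<Phi> \<noteq> 0 \<and> hubbard T U \<Phi> = 0"
      using E(1) by (simp add: eigenvector_on_def)
  next
    assume "\<Phi> \<in> sector m \<and> \<Phi> \<noteq> 0 \<and> hubbard T U \<Phi> = 0"
    then show "ground_state T U m \<Phi>"
      using pos unfolding ground_state_def eigenvector_on_def by (intro exI[of _ 0]) auto
  qed
qed

section \<open>Product states\<close>

definition creat_vec :: "complex ^ 'x \<Rightarrow> 'n \<Rightarrow> ('x::finite, 'n::finite) fock \<Rightarrow> ('x, 'n) fock"
  where "creat_vec v \<gamma> \<Phi> = (\<Sum>x\<in>UNIV. v $ x *s creat x \<gamma> \<Phi>)"

text \<open>An unnormalized Slater determinant with orbitals indexed by sites. The list fixes the
  order of the factors, hence the sign; its head is created last and can be annihilated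
  first.\<close>

primrec slater :: "('x \<Rightarrow> complex ^ 'x) \<Rightarrow> ('x \<Rightarrow> 'n) \<Rightarrow> 'x list \<Rightarrow> ('x::finite, 'n::finite) fock"
  where
    "slater \<mu> \<sigma> [] = (\<chi> S. if S = {} then 1 else 0)"
  | "slater \<mu> \<sigma> (z # L) = creat_vec (\<mu> z) (\<sigma> z) (slater \<mu> \<sigma> L)"

lemma creat_vec_zero [simp]: "creat_vec v \<gamma> 0 = 0"
  by (simp add: creat_vec_def)

lemma annih_creat_vec:
  "annih x \<alpha> (creat_vec v \<gamma> \<Phi>) = (if \<alpha> = \<gamma> then v $ x else 0) *s \<Phi> - creat_vec v \<gamma> (annih x \<alpha> \<Phi>)"
proof -
  have "annih x \<alpha> (creat_vec v \<gamma> \<Phi>) =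
      (\<Sum>y\<in>UNIV. (if x = y then (if \<alpha> = \<gamma> then v $ x else 0) *s \<Phi> else 0) -
        v $ y *s creat y \<gamma> (annih x \<alpha> \<Phi>))"
    unfolding creat_vec_def annih_sum
    by (intro sum.cong refl) (simp add: annih_scale annih_creat_eq vec.scale_right_diff_distrib)
  then show ?thesis
    by (simp add: sum_subtractf creat_vec_def)
qed

lemma slater_in_sector: "slater \<mu> \<sigma> L \<in> sector (length L)"
proof (induction L)
  case Nil
  then show ?case
    by (simp add: sector_iff)
next
  case (Cons z L)
  then show ?case
    by (auto simp: creat_vec_def intro: sector_sum sector_scale creat_in_sector)
qed

text \<open>The combined annihilator passes each creation factor up to a sign and a contraction, and
  the contraction is the bilinear pairing of \<open>u\<close> with an orbital of color \<gamma>.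
  Taking \<open>u\<close> as the indicator of a site or as a row of \<open>T\<close> gives the two
  applications below.\<close>

lemma annih_vec_slater:
  assumes "\<And>z. z \<in> set L \<Longrightarrow> \<sigma> z = \<gamma> \<Longrightarrow> (\<Sum>x\<in>UNIV. u x * \<mu> z $ x) = 0"
  shows "(\<Sum>x\<in>UNIV. u x *s annih x \<gamma> (slater \<mu> \<sigma> L)) = 0"
  using assms
proof (induction L)
  case Nil
  have "annih x \<gamma> (slater \<mu> \<sigma> []) = 0" for x
    by (simp add: annih_def vec_eq_iff)
  then show ?case
    by simp
next
  case (Cons z L)
  define \<Psi> where "\<Psi> = slater \<mu> \<sigma> L"
  have lin: "creat_vec v \<delta> (\<Sum>x\<in>UNIV. u x *s f x) = (\<Sum>x\<in>UNIV. u x *s creat_vec v \<delta> (f x))"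
    for v \<delta> and f :: "_ \<Rightarrow> ('a, 'b) fock"
    unfolding creat_vec_def creat_sum creat_scale vec.scale_sum_right
    by (subst sum.swap) (simp add: vec_eq_iff mult_ac)
  have "(\<Sum>x\<in>UNIV. u x *s annih x \<gamma> (slater \<mu> \<sigma> (z # L))) =
      (\<Sum>x\<in>UNIV. (u x * (if \<gamma> = \<sigma> z then \<mu> z $ x else 0)) *s \<Psi>) -
      creat_vec (\<mu> z) (\<sigma> z) (\<Sum>x\<in>UNIV. u x *s annih x \<gamma> \<Psi>)"
    unfolding lin sum_subtractf[symmetric]
    by (intro sum.cong refl)
       (simp add: \<Psi>_def annih_creat_vec vec.scale_right_diff_distrib del: vec.scale_scale
          flip: vector_smult_assoc)
  also have "(\<Sum>x\<in>UNIV. u x *s annih x \<gamma> \<Psi>) = 0"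
    unfolding \<Psi>_def using Cons by simp
  also have "(\<Sum>x\<in>UNIV. (u x * (if \<gamma> = \<sigma> z then \<mu> z $ x else 0)) *s \<Psi>) = 0"
    using Cons.prems[of z] by (cases "\<gamma> = \<sigma> z") (simp_all flip: vec.scale_sum_left)
  finally show ?case
    by simp
qed

lemma annih_slater_eq_0:
  assumes "\<And>z. z \<in> set L \<Longrightarrow> \<sigma> z = \<gamma> \<Longrightarrow> \<mu> z $ x = 0"
  shows "annih x \<gamma> (slater \<mu> \<sigma> L) = 0"
proof -
  have eq: "(if y = x then 1 else 0) *s v = (if y = x then v else 0)"
    for y and v :: "('a, 'b) fock"
    by simp
  have eq': "(if y = x then 1 else 0) * v = (if y = x then v else 0)" for y and v :: complex
    by simp
  show ?thesis
    using annih_vec_slater[of L \<sigma> \<gamma> "\<lambda>y. if y = x then 1 else 0" \<mu>] assms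
    by (simp add: eq eq')
qed

lemma annih_slater_head:
  assumes "\<mu> z $ z = 1" "\<And>w. w \<in> set L \<Longrightarrow> \<mu> w $ z = 0"
  shows "annih z (\<sigma> z) (slater \<mu> \<sigma> (z # L)) = slater \<mu> \<sigma> L"
  using assms by (simp add: annih_creat_vec annih_slater_eq_0)

text \<open>Annihilating the orbitals one by one from the head leads back to the vacuum, which is
  nonzero.\<close>

lemma slater_nonzero:
  assumes "distinct L" "\<And>w z. w \<in> set L \<Longrightarrow> z \<in> set L \<Longrightarrow> \<mu> w $ z = (if w = z then 1 else 0)"
  shows "slater \<mu> \<sigma> L \<noteq> 0"
  using assms
proof (induction L)
  case Nil
  then show ?case
    by (simp add: vec_eq_iff exI[of _ "{}"])
next
  case (Cons z L)
  have "annih z (\<sigma> z) (slater \<mu> \<sigma> (z # L)) = slater \<mu> \<sigma> L"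
    using Cons.prems by (intro annih_slater_head) auto
  moreover have "slater \<mu> \<sigma> L \<noteq> 0"
    using Cons by auto
  ultimately show ?case
    by (metis annih_zero)
qed

lemma wave_slater_in_kernel:
  assumes "\<And>z. z \<in> set L \<Longrightarrow> \<mu> z \<in> mat_kernel T"
  shows "wave \<alpha> S (slater \<mu> \<sigma> L) \<in> mat_kernel T"
proof -
  have "(T *v wave \<alpha> S (slater \<mu> \<sigma> L)) $ y = 0" for y
  proof -
    have "(T *v wave \<alpha> S (slater \<mu> \<sigma> L)) $ y = (\<Sum>x\<in>UNIV. T $ y $ x *s annih x \<alpha> (slater \<mu> \<sigma> L)) $ S"
      by (simp add: wave_def matrix_vector_mult_def)
    moreover have "(\<Sum>x\<in>UNIV. T $ y $ x * \<mu> z $ x) = 0" if "z \<in> set L" for z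
      using assms[OF that] by (simp add: mat_kernel_def matrix_vector_mult_def vec_eq_iff)
    ultimately show ?thesis
      by (simp add: annih_vec_slater)
  qed
  then show ?thesis
    by (simp add: mat_kernel_def vec_eq_iff)
qed

section \<open>States with one particle per basis site\<close>

text \<open>An abstraction of zero-energy states made for induction: annihilating at a site of
  \<open>J\<close> preserves it once that site is dropped from \<open>J\<close>. The particle number
  is kept apart from \<open>card J\<close> because dropping an empty site lowers only the
  latter.\<close>

definition confined ::
    "('x \<Rightarrow> complex ^ 'x) \<Rightarrow> 'x set \<Rightarrow> nat \<Rightarrow> ('x::finite, 'n::finite) fock \<Rightarrow> bool"
  where "confined \<mu> J m \<Psi> \<longleftrightarrow> \<Psi> \<in> sector m \<and>
    (\<forall>x \<alpha>. annih x \<alpha> \<Psi> = (\<Sum>z\<in>J. \<mu> z $ x *s annih z \<alpha> \<Psi>)) \<and>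
    (\<forall>z\<in>J. \<forall>\<alpha> \<beta>. annih z \<alpha> (annih z \<beta> \<Psi>) = 0)"

lemma confined_expand: "confined \<mu> J m \<Psi> \<Longrightarrow> annih x \<alpha> \<Psi> = (\<Sum>z\<in>J. \<mu> z $ x *s annih z \<alpha> \<Psi>)"
  unfolding confined_def by blast

lemma confined_single: "confined \<mu> J m \<Psi> \<Longrightarrow> z \<in> J \<Longrightarrow> annih z \<alpha> (annih z \<beta> \<Psi>) = 0"
  unfolding confined_def by blast

lemma confined_sector: "confined \<mu> J m \<Psi> \<Longrightarrow> \<Psi> \<in> sector m"
  unfolding confined_def by blast

lemma confined_remove:
  assumes "confined \<mu> J m \<Psi>" "\<And>\<alpha>. annih z \<alpha> \<Psi> = 0"
  shows "confined \<mu> (J - {z}) m \<Psi>"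
proof -
  have "annih x \<alpha> \<Psi> = (\<Sum>w\<in>J - {z}. \<mu> w $ x *s annih w \<alpha> \<Psi>)" for x \<alpha>
    unfolding confined_expand[OF assms(1), of x \<alpha>]
    by (rule sum.mono_neutral_right) (auto simp: assms(2))
  then show ?thesis
    using assms(1) unfolding confined_def by blast
qed

text \<open>The annihilator at \<open>z\<close> anticommutes through both conditions, and single
  occupancy leaves \<open>z\<close> empty afterwards, so \<open>confined_remove\<close>
  applies.\<close>

lemma confined_annih:
  assumes "confined \<mu> J (Suc m) \<Psi>" "z \<in> J"
  shows "confined \<mu> (J - {z}) m (annih z \<gamma> \<Psi>)"
proof (rule confined_remove)
  have "annih x \<alpha> (annih z \<gamma> \<Psi>) = (\<Sum>w\<in>J. \<mu> w $ x *s annih w \<alpha> (annih z \<gamma> \<Psi>))" for x \<alpha>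
  proof -
    have "annih x \<alpha> (annih z \<gamma> \<Psi>) = - annih z \<gamma> (annih x \<alpha> \<Psi>)"
      by (rule annih_anticommute)
    also have "\<dots> = - annih z \<gamma> (\<Sum>w\<in>J. \<mu> w $ x *s annih w \<alpha> \<Psi>)"
      using confined_expand[OF assms(1), of x \<alpha>] by simp
    also have "\<dots> = (\<Sum>w\<in>J. \<mu> w $ x *s annih w \<alpha> (annih z \<gamma> \<Psi>))"
      unfolding annih_sum annih_scale sum_negf[symmetric]
      by (intro sum.cong refl) (simp add: annih_anticommute[of z \<gamma>])
    finally show ?thesis .
  qed
  moreover have "annih w \<alpha> (annih w \<beta> (annih z \<gamma> \<Psi>)) = 0" if "w \<in> J" for w \<alpha> \<beta>
  proof -
    have "annih w \<alpha> (annih w \<beta> (annih z \<gamma> \<Psi>)) = annih z \<gamma> (annih w \<alpha> (annih w \<beta> \<Psi>))"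
      by (simp add: annih_anticommute[of w _ z \<gamma>] annih_uminus)
    then show ?thesis
      using confined_single[OF assms(1) that] by simp
  qed
  ultimately show "confined \<mu> J m (annih z \<gamma> \<Psi>)"
    using annih_in_sector[OF confined_sector[OF assms(1)]] unfolding confined_def by blast
  show "annih z \<alpha> (annih z \<gamma> \<Psi>) = 0" for \<alpha>
    using assms by (rule confined_single)
qed

lemma confined_diff:
  assumes "confined \<mu> J m \<Phi>" "confined \<mu> J m \<Psi>"
  shows "confined \<mu> J m (\<Phi> - \<Psi>)"
proof -
  have "annih x \<alpha> (\<Phi> - \<Psi>) = (\<Sum>z\<in>J. \<mu> z $ x *s annih z \<alpha> (\<Phi> - \<Psi>))" for x \<alpha>
    unfolding annih_diff vec.scale_right_diff_distrib sum_subtractf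
    by (simp only: confined_expand[OF assms(1), of x \<alpha>, symmetric]
        confined_expand[OF assms(2), of x \<alpha>, symmetric])
  moreover have "annih z \<alpha> (annih z \<beta> (\<Phi> - \<Psi>)) = 0" if "z \<in> J" for z \<alpha> \<beta>
    using that assms[THEN confined_single] by (simp add: annih_diff)
  ultimately show ?thesis
    using sector_diff[OF assms[THEN confined_sector]] unfolding confined_def by blast
qed

lemma confined_eq_0:
  assumes "confined \<mu> J m \<Psi>" "m > 0" "\<And>z \<alpha>. z \<in> J \<Longrightarrow> annih z \<alpha> \<Psi> = 0"
  shows "\<Psi> = 0"
proof (rule sector_eq_0[OF confined_sector[OF assms(1)] assms(2)])
  show "annih x \<alpha> \<Psi> = 0" for x \<alpha>
    unfolding confined_expand[OF assms(1), of x \<alpha>] by (simp add: assms(3))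
qed

text \<open>Pigeonhole principle. Annihilating at a site of \<open>J\<close> lowers the particle
  number and the number of sites together, so by induction every annihilated state vanishes.\<close>

lemma overfull_confined:
  assumes "confined \<mu> J m \<Psi>" "card J < m"
  shows "\<Psi> = 0"
  using assms
proof (induction m arbitrary: J \<Psi>)
  case (Suc m)
  show ?case
  proof (rule confined_eq_0[OF Suc.prems(1)])
    fix z \<alpha>
    assume "z \<in> J"
    moreover from this have "card (J - {z}) < m"
      using Suc.prems(2) card_Diff1_less[of J z] by simp
    ultimately show "annih z \<alpha> \<Psi> = 0"
      using Suc confined_annih by blast
  qed simp
qed simp

section \<open>Exchange of colors between two sites\<close>

definition exchangeable :: "'x \<Rightarrow> 'x \<Rightarrow> ('x::finite, 'n::finite) fock \<Rightarrow> bool"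
  where "exchangeable p q \<Phi> \<longleftrightarrow> (\<forall>\<alpha> \<beta>. annih p \<beta> (annih q \<alpha> \<Phi>) = annih p \<alpha> (annih q \<beta> \<Phi>))"

lemma annih_past_pair:
  "annih z \<gamma> (annih p \<beta> (annih q \<alpha> \<Phi>)) = annih p \<beta> (annih q \<alpha> (annih z \<gamma> \<Phi>))"
  by (simp add: annih_anticommute[of z \<gamma>] annih_uminus)

lemma exchangeable_annih: "exchangeable p q \<Phi> \<Longrightarrow> exchangeable p q (annih z \<gamma> \<Phi>)"
  unfolding exchangeable_def by (simp only: annih_past_pair[of z \<gamma> p _ q, symmetric] simp_thms)

lemma confined_exchange_defect:
  assumes "confined \<mu> J (Suc (Suc m)) \<Phi>" "p \<in> J" "q \<in> J" "p \<noteq> q"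
  shows "confined \<mu> (J - {q} - {p}) m (annih p \<beta> (annih q \<alpha> \<Phi>) - annih p \<alpha> (annih q \<beta> \<Phi>))"
  using assms by (intro confined_diff confined_annih) auto

text \<open>If only \<open>p\<close> and \<open>q\<close> are present, expanding both annihilators
  at \<open>x\<close> leaves cross terms with the factor \<open>\<mu> p $ x * \<mu> q $ x\<close>,
  which can be divided out. Further sites are handled by induction: annihilating there keeps the
  hypotheses, and an exchange defect killed by all these annihilators is zero.\<close>

lemma exchangeable_overlap:
  assumes "confined \<mu> J (card J) \<Phi>" "p \<in> J" "q \<in> J" "p \<noteq> q"
    and "\<And>\<alpha> \<beta>. annih x \<beta> (annih x \<alpha> \<Phi>) = 0"
    and "\<mu> p $ x \<noteq> 0" "\<mu> q $ x \<noteq> 0"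
  shows "exchangeable p q \<Phi>"
  using assms(1-5)
proof (induction "card J" arbitrary: J \<Phi>)
  case 0
  then show ?case
    by (metis card_0_eq empty_iff finite)
next
  case (Suc k)
  show ?case
  proof (cases "J = {p, q}")
    case True
    have two: "annih x \<gamma> \<Psi> = \<mu> p $ x *s annih p \<gamma> \<Psi> + \<mu> q $ x *s annih q \<gamma> \<Psi>"
      if "annih x \<gamma> \<Psi> = (\<Sum>z\<in>J. \<mu> z $ x *s annih z \<gamma> \<Psi>)" for \<gamma> and \<Psi> :: "('a, 'b) fock"
      using that Suc.prems True by simp
    note single = confined_single[OF Suc.prems(1)]
    have "annih p \<beta> (annih q \<alpha> \<Phi>) = annih p \<alpha> (annih q \<beta> \<Phi>)" for \<alpha> \<beta>
    proof -
      have \<Phi>: "annih x \<gamma> \<Phi> = \<mu> p $ x *s annih p \<gamma> \<Phi> + \<mu> q $ x *s annih q \<gamma> \<Phi>" for \<gamma>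
        using two confined_expand[OF Suc.prems(1)] by blast
      have z: "annih x \<beta> (annih z \<alpha> \<Phi>) = - annih z \<alpha> (annih x \<beta> \<Phi>)" for z
        by (rule annih_anticommute)
      have "0 = annih x \<beta> (annih x \<alpha> \<Phi>)"
        using Suc.prems by simp
      also have "\<dots> = - (\<mu> p $ x *s annih p \<alpha> (annih x \<beta> \<Phi>) + \<mu> q $ x *s annih q \<alpha> (annih x \<beta> \<Phi>))"
        by (subst \<Phi>[of \<alpha>]) (simp add: annih_add annih_scale z)
      \<comment> \<open>The diagonal terms vanish because \<open>p\<close> and \<open>q\<close> are
        singly occupied.\<close>
      also have "\<dots> = - ((\<mu> p $ x * \<mu> q $ x) *s (annih p \<alpha> (annih q \<beta> \<Phi>) + annih q \<alpha> (annih p \<beta> \<Phi>)))"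
        unfolding \<Phi> annih_add annih_scale using single[of p] single[of q] Suc.prems(2,3)
        by (simp add: vec_eq_iff algebra_simps)
      finally have "(\<mu> p $ x * \<mu> q $ x) *s (annih p \<alpha> (annih q \<beta> \<Phi>) + annih q \<alpha> (annih p \<beta> \<Phi>)) = 0"
        by (metis neg_equal_0_iff_equal)
      then have "annih p \<alpha> (annih q \<beta> \<Phi>) + annih q \<alpha> (annih p \<beta> \<Phi>) = 0"
        unfolding vec.scale_eq_0_iff using assms(6,7) by simp
      then show ?thesis
        using annih_anticommute[of q \<alpha> p \<beta> \<Phi>] by simp
    qed
    then show ?thesis
      by (simp add: exchangeable_def)
  next
    case False
    have "card {p, q} < card J"
      using False Suc.prems(2,3) by (intro psubset_card_mono) auto
    \<comment> \<open>A third site guarantees that a particle is left besides those at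
      \<open>p\<close> and \<open>q\<close>, as \<open>confined_eq_0\<close> requires.\<close>
    then obtain m where m: "card J = Suc (Suc m)" "m > 0"
      using Suc.prems(4) by (metis card_2_iff less_iff_Suc_add numeral_2_eq_2 add_Suc zero_less_Suc)
    have "annih p \<beta> (annih q \<alpha> \<Phi>) - annih p \<alpha> (annih q \<beta> \<Phi>) = 0" for \<alpha> \<beta>
    proof (rule confined_eq_0)
      show "confined \<mu> (J - {q} - {p}) m (annih p \<beta> (annih q \<alpha> \<Phi>) - annih p \<alpha> (annih q \<beta> \<Phi>))"
        using Suc.prems m by (intro confined_exchange_defect) auto
      show "annih z \<gamma> (annih p \<beta> (annih q \<alpha> \<Phi>) - annih p \<alpha> (annih q \<beta> \<Phi>)) = 0"
        if "z \<in> J - {q} - {p}" for z \<gamma>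
      proof -
        have k: "k = card (J - {z})"
          using Suc.hyps(2) that by simp
        have "annih x \<beta> (annih x \<alpha> (annih z \<gamma> \<Phi>)) = 0" for \<alpha> \<beta>
          using Suc.prems(5) by (simp add: annih_past_pair[of z \<gamma> x _ x, symmetric])
        moreover have "confined \<mu> (J - {z}) (card (J - {z})) (annih z \<gamma> \<Phi>)"
          using Suc.prems(1) that k Suc.hyps(2) by (intro confined_annih) auto
        ultimately have "exchangeable p q (annih z \<gamma> \<Phi>)"
          using Suc.prems(2-4) that by (intro Suc.hyps(1)[OF k]) auto
        then show ?thesis
          by (simp add: annih_diff annih_past_pair[of z \<gamma> p _ q] exchangeable_def)
      qed
    qed (fact m)
    then show ?thesis
      by (simp add: exchangeable_def)
  qed
qed

text \<open>The exchange defect of \<open>p\<close> and \<open>r\<close> has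
  \<open>card J - 2\<close> particles. Exchanging through \<open>q\<close> shows that it has none at
  \<open>q\<close>, so only \<open>card J - 3\<close> sites can hold them, and
  \<open>overfull_confined\<close> makes it vanish.\<close>

lemma exchangeable_trans:
  assumes "confined \<mu> J (card J) \<Phi>" "p \<in> J" "q \<in> J" "r \<in> J"
    and pq: "exchangeable p q \<Phi>" and qr: "exchangeable q r \<Phi>"
  shows "exchangeable p r \<Phi>"
proof (cases "p = q \<or> q = r \<or> p = r")
  case True
  then show ?thesis
    using pq qr confined_single[OF assms(1)] assms(2-4) by (auto simp: exchangeable_def)
next
  case False
  have "card {p, q, r} \<le> card J"
    using assms(2-4) by (intro card_mono) auto
  then obtain m where m: "card J = Suc (Suc (Suc m))"
    using False by (auto simp: card_insert_if le_iff_add)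
  have "annih p \<beta> (annih r \<alpha> \<Phi>) - annih p \<alpha> (annih r \<beta> \<Phi>) = 0" for \<alpha> \<beta>
  proof (rule overfull_confined)
    show "confined \<mu> (J - {r} - {p} - {q}) (Suc m) (annih p \<beta> (annih r \<alpha> \<Phi>) - annih p \<alpha> (annih r \<beta> \<Phi>))"
    proof (rule confined_remove)
      show "confined \<mu> (J - {r} - {p}) (Suc m) (annih p \<beta> (annih r \<alpha> \<Phi>) - annih p \<alpha> (annih r \<beta> \<Phi>))"
        using assms False m by (intro confined_exchange_defect) auto
      fix \<gamma>
      \<comment> \<open>The transposition of \<open>p\<close> and \<open>r\<close> is composed of
        those of \<open>q\<close> and \<open>r\<close>, then \<open>p\<close> and \<open>q\<close>,
        then \<open>q\<close> and \<open>r\<close> again.\<close>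
      have swap: "annih q \<gamma> (annih p \<beta> (annih r \<alpha> \<Phi>)) = - annih p \<alpha> (annih q \<gamma> (annih r \<beta> \<Phi>))" for \<alpha> \<beta>
      proof -
        have "annih q \<gamma> (annih p \<beta> (annih r \<alpha> \<Phi>)) = - annih p \<beta> (annih q \<gamma> (annih r \<alpha> \<Phi>))"
          by (rule annih_anticommute)
        also have "\<dots> = - annih p \<beta> (annih q \<alpha> (annih r \<gamma> \<Phi>))"
          using qr by (simp add: exchangeable_def)
        also have "\<dots> = - annih p \<alpha> (annih q \<beta> (annih r \<gamma> \<Phi>))"
          using exchangeable_annih[OF pq, of r \<gamma>] by (simp add: exchangeable_def)
        also have "\<dots> = - annih p \<alpha> (annih q \<gamma> (annih r \<beta> \<Phi>))"
          using qr by (simp add: exchangeable_def)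
        finally show ?thesis .
      qed
      show "annih q \<gamma> (annih p \<beta> (annih r \<alpha> \<Phi>) - annih p \<alpha> (annih r \<beta> \<Phi>)) = 0"
        unfolding annih_diff swap[of \<beta> \<alpha>] by (simp add: annih_anticommute[of q])
    qed
    have "card (J - {p, q, r}) = card J - card {p, q, r}"
      using assms(2-4) by (intro card_Diff_subset) auto
    moreover have "J - {r} - {p} - {q} = J - {p, q, r}"
      by blast
    ultimately show "card (J - {r} - {p} - {q}) < Suc m"
      using False m by simp
  qed
  then show ?thesis
    by (simp add: exchangeable_def)
qed

text \<open>Both annihilators expand over \<open>J\<close> with coefficients that do not depend on
  the color.\<close>

lemma exchangeable_everywhere:
  assumes "confined \<mu> J m \<Phi>" "\<And>p q. p \<in> J \<Longrightarrow> q \<in> J \<Longrightarrow> exchangeable p q \<Phi>"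
  shows "exchangeable y x \<Phi>"
proof -
  have "annih y \<beta> (annih x \<alpha> \<Phi>) = (\<Sum>z\<in>J. \<mu> z $ x *s (\<Sum>w\<in>J. \<mu> w $ y *s annih w \<beta> (annih z \<alpha> \<Phi>)))"
    for \<alpha> \<beta>
  proof -
    \<comment> \<open>The expansion is available for \<open>\<Phi>\<close> itself, so the
      annihilator at \<open>y\<close> is first moved inside.\<close>
    have "annih y \<beta> (annih z \<alpha> \<Phi>) = (\<Sum>w\<in>J. \<mu> w $ y *s annih w \<beta> (annih z \<alpha> \<Phi>))" for z
    proof -
      have "annih y \<beta> (annih z \<alpha> \<Phi>) = - annih z \<alpha> (\<Sum>w\<in>J. \<mu> w $ y *s annih w \<beta> \<Phi>)"
        by (subst annih_anticommute) (simp add: confined_expand[OF assms(1), of y \<beta>, symmetric])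
      then show ?thesis
        by (simp add: annih_sum annih_scale annih_anticommute[of _ \<beta> z \<alpha>] sum_negf)
    qed
    moreover have "annih y \<beta> (annih x \<alpha> \<Phi>) = (\<Sum>z\<in>J. \<mu> z $ x *s annih y \<beta> (annih z \<alpha> \<Phi>))"
      by (subst confined_expand[OF assms(1), of x \<alpha>]) (simp add: annih_sum annih_scale)
    ultimately show ?thesis
      by simp
  qed
  moreover have "annih w \<beta> (annih z \<alpha> \<Phi>) = annih w \<alpha> (annih z \<beta> \<Phi>)" if "w \<in> J" "z \<in> J" for w z \<alpha> \<beta>
    using assms(2)[OF that] by (simp add: exchangeable_def)
  ultimately show ?thesis
    by (simp add: exchangeable_def cong: sum.cong)
qed

section \<open>A dual basis of the kernel\<close>

lemma mat_kernel_subspace: "vec.subspace (mat_kernel A)"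
  by (rule vec.subspaceI)
     (auto simp: mat_kernel_def matrix_vector_right_distrib vector_scalar_commute)

section \<open>Orthogonal projections and their columns\<close>

lemma orth_proj_in: "is_orth_proj P S \<Longrightarrow> P *v v \<in> S"
  by (simp add: is_orth_proj_def)

lemma orth_proj_cinner:
  assumes "is_orth_proj P S" "w \<in> S"
  shows "cinner w (P *v v) = cinner w v" "cinner (P *v v) w = cinner v w"
proof -
  have "cinner w (v - P *v v) = 0"
    using assms unfolding is_orth_proj_def by blast
  then show *: "cinner w (P *v v) = cinner w v"
    by (simp add: cinner_diff_right)
  show "cinner (P *v v) w = cinner v w"
    using * cinner_commute[of "P *v v" w] cinner_commute[of v w] by simp
qed

lemma orth_proj_id:
  assumes "is_orth_proj P S" "vec.subspace S" "v \<in> S"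
  shows "P *v v = v"
proof -
  have "v - P *v v \<in> S"
    using assms orth_proj_in vec.subspace_diff by blast
  then have "cinner (v - P *v v) (v - P *v v) = 0"
    using assms(1) unfolding is_orth_proj_def by blast
  then show ?thesis
    using cinner_self_eq_0_iff[of "v - P *v v"] by simp
qed

lemma mult_axis_nth: "(P *v axis x 1) $ y = P $ y $ (x::'x::finite)" for P :: "complex ^ 'x ^ 'y"
proof -
  have "(P *v axis x 1) $ y = (\<Sum>i\<in>UNIV. if i = x then P $ y $ i else 0)"
    unfolding matrix_vector_mult_def vec_lambda_beta by (rule sum.cong) (auto simp: axis_def)
  then show ?thesis
    by simp
qed

text \<open>Column \<open>x\<close> of the projection represents evaluation at \<open>x\<close> on
  \<open>S\<close>; this gives access to the entries of \<open>P\<close>.\<close>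

lemma orth_proj_entry:
  assumes "is_orth_proj P S" "v \<in> S"
  shows "cinner (P *v axis x 1) v = v $ x"
  using assms by (simp add: orth_proj_cinner cinner_axis)

text \<open>The diagonal entry is the squared norm of column \<open>x\<close>, and a zero column
  represents the zero functional.\<close>

lemma orth_proj_diag_eq_0:
  assumes "is_orth_proj P S" "P $ x $ x = 0" "v \<in> S"
  shows "v $ x = 0"
proof -
  have "cinner (P *v axis x 1) (P *v axis x 1) = 0"
    using assms orth_proj_entry[OF assms(1) orth_proj_in[OF assms(1)]] by (simp add: mult_axis_nth)
  then have "P *v axis x 1 = 0"
    using cinner_self_eq_0_iff[of "P *v axis x 1"] by simp
  then show ?thesis
    using orth_proj_entry[OF assms(1,3), of x] by (simp add: cinner_def)
qed

lemma orth_proj_off_diag_cnj: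
  assumes "is_orth_proj P S"
  shows "P $ x $ y = cnj (P $ y $ x)"
proof -
  note entry = orth_proj_entry[OF assms orth_proj_in[OF assms]]
  have "P $ x $ y = cinner (P *v axis x 1) (P *v axis y 1)"
    by (simp add: entry mult_axis_nth)
  also have "\<dots> = cnj (cinner (P *v axis y 1) (P *v axis x 1))"
    by (rule cinner_commute)
  also have "\<dots> = cnj (P $ y $ x)"
    by (simp add: entry mult_axis_nth)
  finally show ?thesis .
qed

definition dual_basis :: "(complex ^ 'x) set \<Rightarrow> 'x set \<Rightarrow> ('x \<Rightarrow> complex ^ 'x) \<Rightarrow> bool"
  where "dual_basis K I \<mu> \<longleftrightarrow>
    (\<forall>z\<in>I. \<mu> z \<in> K) \<and> (\<forall>z\<in>I. \<forall>w\<in>I. \<mu> z $ w = (if z = w then 1 else 0)) \<and>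
    (\<forall>v\<in>K. \<forall>x. v $ x = (\<Sum>z\<in>I. \<mu> z $ x * v $ z))"

text \<open>The sites \<open>I\<close> index a maximal independent set of columns of the projection \<open>P\<close>; since
  \<open>v $ x\<close> is the inner product of column \<open>x\<close> with \<open>v\<close>, the linear relations among the
  columns become the relations which express \<open>v\<close> by its values on \<open>I\<close>.\<close>

lemma dual_basis_exists:
  fixes P :: "complex ^ 'x::finite ^ 'x"
  assumes P: "is_orth_proj P K" and K: "vec.subspace K"
  obtains I \<mu> where "dual_basis K I \<mu>" "card I = vec.dim K"
proof -
  define col where "col x = P *v axis x 1" for x
  obtain B where B: "B \<subseteq> range col" "vec.independent B" "range col \<subseteq> vec.span B"
    using vec.maximal_independent_subset by blast
  obtain I where I: "inj_on col I" "B = col ` I"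
    using B(1) unfolding subset_image_inj by blast
  have col_K: "col x \<in> K" for x
    unfolding col_def by (rule orth_proj_in[OF P])
  have B_K: "B \<subseteq> K"
    using I col_K by blast
  have K_span: "K \<subseteq> vec.span B"
  proof
    fix v
    assume "v \<in> K"
    then have "v = P *v v"
      using orth_proj_id[OF P K] by simp
    also have "\<dots> = (\<Sum>x\<in>UNIV. v $ x *s col x)"
      by (simp add: vec_eq_iff col_def mult_axis_nth)
         (simp add: matrix_vector_mult_def mult.commute)
    also have "\<dots> \<in> vec.span B"
      using B(3) by (intro vec.span_sum vec.span_scale) blast
    finally show "v \<in> vec.span B" .
  qed
  have card_I: "card I = vec.dim K"
    using vec.basis_card_eq_dim[OF B_K K_span B(2)] I card_image by metis
  \<comment> \<open>Conjugated, because the columns stand in the conjugate-linear argument of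
    \<open>cinner\<close>.\<close>
  define \<mu> where "\<mu> z = (\<chi> x. cnj (vec.representation B (col x) (col z)))" for z
  have rep: "col x = (\<Sum>z\<in>I. vec.representation B (col x) (col z) *s col z)" for x
  proof -
    have "col x = (\<Sum>b\<in>B. vec.representation B (col x) b *s b)"
      using B I by (intro vec.sum_representation_eq[symmetric]) auto
    then show ?thesis
      using I by (simp add: sum.reindex)
  qed
  have delta: "\<mu> z $ w = (if z = w then 1 else 0)" if "z \<in> I" "w \<in> I" for z w
    using that I B(2) by (auto simp: \<mu>_def vec.representation_basis inj_on_eq_iff)
  have expand: "v $ x = (\<Sum>z\<in>I. \<mu> z $ x * v $ z)" if "v \<in> K" for v x
  proof -
    have col: "cinner (col x) v = v $ x" for x
      unfolding col_def using P that by (rule orth_proj_entry)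
    have "v $ x = cnj (cinner v (col x))"
      by (simp add: cinner_commute[of v "col x"] col)
    also have "\<dots> = cnj (cinner v (\<Sum>z\<in>I. vec.representation B (col x) (col z) *s col z))"
      by (rule arg_cong[OF rep, where f = "\<lambda>w. cnj (cinner v w)"])
    also have "\<dots> = (\<Sum>z\<in>I. \<mu> z $ x * cnj (cinner v (col z)))"
      by (simp add: cinner_sum_right cinner_scale_right \<mu>_def)
    also have "\<dots> = (\<Sum>z\<in>I. \<mu> z $ x * v $ z)"
      by (simp add: cinner_commute[of v "col _"] col)
    finally show ?thesis .
  qed
  \<comment> \<open>Membership of each \<open>\<mu> z\<close> in \<open>K\<close> comes from a
    dimension count: the span contains \<open>K\<close> and has at most
    \<open>card I = vec.dim K\<close> dimensions.\<close>
  have span: "K = vec.span (\<mu> ` I)"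
  proof (rule vec.subspace_dim_equal)
    show "K \<subseteq> vec.span (\<mu> ` I)"
    proof
      fix v
      assume "v \<in> K"
      then have "v = (\<Sum>z\<in>I. v $ z *s \<mu> z)"
        using expand by (simp add: vec_eq_iff mult.commute)
      also have "\<dots> \<in> vec.span (\<mu> ` I)"
        by (intro vec.span_sum vec.span_scale vec.span_base) auto
      finally show "v \<in> vec.span (\<mu> ` I)" .
    qed
    have "vec.dim (vec.span (\<mu> ` I)) \<le> card (\<mu> ` I)"
      by (rule vec.dim_le_card) auto
    also have "\<dots> \<le> card I"
      by (rule card_image_le) simp
    finally show "vec.dim (vec.span (\<mu> ` I)) \<le> vec.dim K"
      by (simp add: card_I)
  qed (simp_all add: K)
  have "\<mu> z \<in> K" if "z \<in> I" for z
    unfolding span using that by (intro vec.span_base) auto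
  then have "dual_basis K I \<mu>"
    using delta expand unfolding dual_basis_def by blast
  then show ?thesis
    using card_I that by blast
qed

lemma dual_basis_in: "dual_basis K I \<mu> \<Longrightarrow> z \<in> I \<Longrightarrow> \<mu> z \<in> K"
  unfolding dual_basis_def by blast

lemma dual_basis_delta:
  "dual_basis K I \<mu> \<Longrightarrow> z \<in> I \<Longrightarrow> w \<in> I \<Longrightarrow> \<mu> z $ w = (if z = w then 1 else 0)"
  unfolding dual_basis_def by blast

lemma dual_basis_expand: "dual_basis K I \<mu> \<Longrightarrow> v \<in> K \<Longrightarrow> v $ x = (\<Sum>z\<in>I. \<mu> z $ x * v $ z)"
  unfolding dual_basis_def by blast

lemma dual_basis_eqI:
  assumes "dual_basis K I \<mu>" "v \<in> K" "w \<in> K" "\<And>z. z \<in> I \<Longrightarrow> v $ z = w $ z"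
  shows "v = w"
proof -
  have "v $ x = w $ x" for x
    unfolding dual_basis_expand[OF assms(1,2), of x] dual_basis_expand[OF assms(1,3), of x]
    by (simp add: assms(4))
  then show ?thesis
    by (simp add: vec_eq_iff)
qed

section \<open>Disconnected overlap graphs and reducibility of the projection\<close>

definition splits :: "('x \<Rightarrow> complex ^ 'x) \<Rightarrow> 'x set \<Rightarrow> 'x set \<Rightarrow> 'x set \<Rightarrow> bool"
  where "splits \<mu> I A B \<longleftrightarrow> I = A \<union> B \<and> A \<inter> B = {} \<and> A \<noteq> {} \<and> B \<noteq> {} \<and>
    (\<forall>x. \<forall>p\<in>A. \<forall>q\<in>B. \<mu> p $ x = 0 \<or> \<mu> q $ x = 0)"

text \<open>The supports of the two halves serve as the two blocks. A column at a site of
  \<open>supp B\<close> is the sum of an \<open>A\<close> part and a \<open>B\<close> part. The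
  \<open>A\<close> part lies in \<open>K\<close> and vanishes at that site, so it is orthogonal to
  the column; being also orthogonal to the \<open>B\<close> part, it is orthogonal to
  itself.\<close>

lemma splits_imp_reducible:
  assumes P: "is_orth_proj P K" and K: "vec.subspace K" and \<mu>: "dual_basis K I \<mu>"
    and split: "splits \<mu> I A B"
  shows "reducible_on P {x. P $ x $ x \<noteq> 0}"
proof -
  define supp where "supp C = {x. \<exists>z\<in>C. \<mu> z $ x \<noteq> 0}" for C
  have I: "I = A \<union> B" "A \<inter> B = {}"
    using split by (auto simp: splits_def)
  have supp_subset: "supp C \<subseteq> {x. P $ x $ x \<noteq> 0}" if "C \<subseteq> I" for C
    using that orth_proj_diag_eq_0[OF P] dual_basis_in[OF \<mu>] by (fastforce simp: supp_def)
  have union: "{x. P $ x $ x \<noteq> 0} = supp A \<union> supp B"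
  proof
    show "{x. P $ x $ x \<noteq> 0} \<subseteq> supp A \<union> supp B"
    proof
      fix x
      assume "x \<in> {x. P $ x $ x \<noteq> 0}"
      then have "(\<Sum>z\<in>I. \<mu> z $ x * (P *v axis x 1) $ z) \<noteq> 0"
        using dual_basis_expand[OF \<mu> orth_proj_in[OF P], of "axis x 1" x]
        by (simp add: mult_axis_nth)
      then obtain z where "z \<in> I" "\<mu> z $ x * (P *v axis x 1) $ z \<noteq> 0"
        by (rule sum.not_neutral_contains_not_neutral)
      then show "x \<in> supp A \<union> supp B"
        using I by (auto simp: supp_def)
    qed
  qed (use supp_subset I in auto)
  have disj: "supp A \<inter> supp B = {}"
    using split by (fastforce simp: splits_def supp_def)
  have ne: "supp A \<noteq> {}" "supp B \<noteq> {}"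
  proof -
    have "C \<subseteq> supp C" if "C \<subseteq> I" for C
      using dual_basis_delta[OF \<mu>] that by (force simp: supp_def)
    from this[of A] this[of B] show "supp A \<noteq> {}" "supp B \<noteq> {}"
      using split I by (auto simp: splits_def)
  qed
  have "P $ y $ x = 0" if x: "x \<in> supp B" and y: "y \<in> supp A" for x y
  proof -
    define v where "v = P *v axis x 1"
    have v: "v \<in> K"
      unfolding v_def by (rule orth_proj_in[OF P])
    define part where "part C = (\<Sum>z\<in>C. v $ z *s \<mu> z)" for C
    have part_nth: "part C $ w = (\<Sum>z\<in>C. \<mu> z $ w * v $ z)" for C w
      by (simp add: part_def mult.commute)
    have part_0: "part C $ w = 0" if "w \<notin> supp C" for C w
      using that unfolding part_nth by (intro sum.neutral) (auto simp: supp_def)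
    have v_parts: "v = part A + part B"
    proof -
      have "v $ w = (part A + part B) $ w" for w
        by (subst dual_basis_expand[OF \<mu> v, of w]) (simp add: part_nth I sum.union_disjoint)
      then show ?thesis
        unfolding vec_eq_iff by blast
    qed
    have "part A \<in> K"
      unfolding part_def using I
      by (intro vec.subspace_sum[OF K] vec.subspace_scale[OF K] dual_basis_in[OF \<mu>]) auto
    then have "cinner v (part A) = part A $ x"
      unfolding v_def by (rule orth_proj_entry[OF P])
    also have "\<dots> = 0"
      using x disj by (intro part_0) auto
    finally have "cinner (part A) (part A) + cinner (part B) (part A) = 0"
      by (simp add: v_parts cinner_add_left)
    moreover have "cinner (part B) (part A) = 0"
    proof -
      have "part A $ w = 0 \<or> part B $ w = 0" for w
        using part_0[of w A] part_0[of w B] disj by blast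
      then show ?thesis
        unfolding cinner_def by (intro sum.neutral) auto
    qed
    ultimately have "part A = 0"
      using cinner_self_eq_0_iff[of "part A"] by simp
    then have "v $ y = part B $ y"
      using v_parts by simp
    also have "\<dots> = 0"
      using y disj by (intro part_0) auto
    finally show ?thesis
      by (simp add: v_def mult_axis_nth)
  qed
  then show ?thesis
    unfolding reducible_on_def using union disj ne by blast
qed

text \<open>With both off-diagonal blocks zero, cutting a vector of \<open>K\<close> down to one
  block stays in \<open>K\<close>. A dual vector agrees on \<open>I\<close> with its cut to the
  block of its own site, hence equals it, so dual vectors of different blocks never overlap.\<close>

lemma reducible_imp_splits:
  assumes P: "is_orth_proj P K" and K: "vec.subspace K" and \<mu>: "dual_basis K I \<mu>"
    and red: "reducible_on P {x. P $ x $ x \<noteq> 0}"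
  obtains A B where "splits \<mu> I A B"
proof -
  obtain L1 L2 where L: "{x. P $ x $ x \<noteq> 0} = L1 \<union> L2" "L1 \<inter> L2 = {}" "L1 \<noteq> {}" "L2 \<noteq> {}"
    and "\<forall>x\<in>L1. \<forall>y\<in>L2. P $ x $ y = 0"
    using red unfolding reducible_on_def by (elim exE conjE) (rule that)
  then have L12: "P $ x $ y = 0" if "x \<in> L1" "y \<in> L2" for x y
    using that by simp
  \<comment> \<open>Reducibility provides one zero block; the other follows since \<open>P\<close>
    is Hermitian.\<close>
  have L21: "P $ y $ x = 0" if "x \<in> L1" "y \<in> L2" for x y
    using L12[OF that] orth_proj_off_diag_cnj[OF P, of y x] by simp
  have I_sub: "I \<subseteq> L1 \<union> L2"
  proof
    fix z
    assume "z \<in> I"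
    then have "\<mu> z $ z \<noteq> 0" "\<mu> z \<in> K"
      using dual_basis_delta[OF \<mu>] dual_basis_in[OF \<mu>] by auto
    then show "z \<in> L1 \<union> L2"
      using orth_proj_diag_eq_0[OF P] L(1) by blast
  qed
  have restrict: "(\<chi> x. if x \<in> M then v $ x else 0) \<in> K"
    if "v \<in> K" and M: "M = L1 \<or> M = L2" for v M
  proof -
    define u where "u = (\<chi> x. if x \<in> M then v $ x else 0)"
    have "(P *v u) $ y = u $ y" for y
    proof (cases "y \<in> M")
      case True
      have "(P *v u) $ y = (P *v v) $ y"
        unfolding matrix_vector_mult_def vec_lambda_beta
      proof (rule sum.cong[OF refl])
        fix x
        show "P $ y $ x * u $ x = P $ y $ x * v $ x"
        proof (cases "x \<in> L1 \<union> L2")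
          case True
          then show ?thesis
            using M \<open>y \<in> M\<close> L12 L21 by (auto simp: u_def)
        next
          case False
          then have "v $ x = 0"
            using orth_proj_diag_eq_0[OF P _ \<open>v \<in> K\<close>, of x] L(1) by blast
          then show ?thesis
            by (simp add: u_def)
        qed
      qed
      then show ?thesis
        using True orth_proj_id[OF P K \<open>v \<in> K\<close>] by (simp add: u_def)
    next
      case False
      have "P $ y $ x = 0" if "x \<in> M" for x
      proof (cases "y \<in> L1 \<union> L2")
        case True
        then show ?thesis
          using False that M L12 L21 by auto
      next
        case False
        then have "P $ y $ y = 0"
          using L(1) by blast
        then show ?thesis
          using orth_proj_diag_eq_0[OF P _ orth_proj_in[OF P], of y "axis x 1"]
          by (simp add: mult_axis_nth)
      qed
      then show ?thesis
        using False by (auto simp: u_def matrix_vector_mult_def intro!: sum.neutral)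
    qed
    then have "P *v u = u"
      by (simp add: vec_eq_iff)
    then show ?thesis
      using orth_proj_in[OF P, of u] by (simp add: u_def)
  qed
  have supported: "\<mu> z $ x = 0" if "z \<in> I" "z \<in> M" "x \<notin> M" "M = L1 \<or> M = L2" for z x M
  proof -
    have "\<mu> z = (\<chi> x. if x \<in> M then \<mu> z $ x else 0)"
      using restrict[OF dual_basis_in[OF \<mu> that(1)] that(4)] dual_basis_delta[OF \<mu>] that
      by (intro dual_basis_eqI[OF \<mu>] dual_basis_in[OF \<mu>]) auto
    then have "\<mu> z $ x = (if x \<in> M then \<mu> z $ x else 0)"
      unfolding vec_eq_iff vec_lambda_beta by blast
    then show ?thesis
      using that(3) by simp
  qed
  \<comment> \<open>If \<open>I\<close> missed one block, all dual vectors would vanish there, hence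
    so would the columns of \<open>P\<close> and with them its diagonal entries.\<close>
  have nonempty: "I \<inter> M \<noteq> {}" if M: "M = L1 \<and> M' = L2 \<or> M = L2 \<and> M' = L1" for M M'
  proof
    assume empty: "I \<inter> M = {}"
    obtain x where x: "x \<in> M"
      using M L by blast
    then have "x \<notin> M'"
      using M L by blast
    have "I \<subseteq> M'"
      using I_sub M empty by blast
    then have "\<mu> z $ x = 0" if "z \<in> I" for z
      using supported[OF that, of M' x] that M \<open>x \<notin> M'\<close> by blast
    then have "P $ x $ x = 0"
      using dual_basis_expand[OF \<mu> orth_proj_in[OF P], of "axis x 1" x] by (simp add: mult_axis_nth)
    then show False
      using x M L(1) by blast
  qed
  have "splits \<mu> I (I \<inter> L1) (I \<inter> L2)"
    unfolding splits_def
  proof (intro conjI ballI allI)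
    show "I \<inter> L1 \<noteq> {}" "I \<inter> L2 \<noteq> {}"
      using nonempty[of L1 L2] nonempty[of L2 L1] by auto
    show "\<mu> p $ x = 0 \<or> \<mu> q $ x = 0" if "p \<in> I \<inter> L1" "q \<in> I \<inter> L2" for x p q
      using that supported[of p L1 x] supported[of q L2 x] L(2) by blast
  qed (use I_sub L in auto)
  then show ?thesis
    using that by blast
qed

section \<open>Ground states and reducibility\<close>

text \<open>The wave functions lie in the kernel and expand in the dual basis; doing this for every
  component \<open>S\<close> yields the expansion of the annihilated state.\<close>

lemma zero_energy_confined:
  fixes \<Phi> :: "('x::finite, 'n::{finite,linorder}) fock"
  assumes "pos_semidef T" "U > 0" "dual_basis (mat_kernel T) I \<mu>"
    and "\<Phi> \<in> sector m" "hubbard T U \<Phi> = 0"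
  shows "confined \<mu> I m \<Phi>"
proof -
  have zero: "\<forall>\<alpha> S. wave \<alpha> S \<Phi> \<in> mat_kernel T" "\<forall>x \<alpha> \<beta>. annih x \<beta> (annih x \<alpha> \<Phi>) = 0"
    using assms(5) hubbard_eq_0_iff[OF assms(1,2)] by blast+
  have "annih x \<alpha> \<Phi> $ S = (\<Sum>z\<in>I. \<mu> z $ x *s annih z \<alpha> \<Phi>) $ S" for x \<alpha> S
    using dual_basis_expand[OF assms(3), of "wave \<alpha> S \<Phi>" x] zero(1)
    by (simp add: wave_def)
  then have "annih x \<alpha> \<Phi> = (\<Sum>z\<in>I. \<mu> z $ x *s annih z \<alpha> \<Phi>)" for x \<alpha>
    unfolding vec_eq_iff by blast
  then show ?thesis
    using zero(2) assms(4) unfolding confined_def by blast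
qed

text \<open>Orbitals of different colors have disjoint supports, so at each site one of two
  different annihilators already gives 0; equal colors are excluded by the Pauli principle.\<close>

lemma slater_zero_energy:
  fixes \<sigma> :: "'x::finite \<Rightarrow> 'n::{finite,linorder}"
  assumes "pos_semidef T" "U > 0" "dual_basis (mat_kernel T) I \<mu>"
    and "set L = I"
    and "\<And>p q x. p \<in> I \<Longrightarrow> q \<in> I \<Longrightarrow> \<sigma> p \<noteq> \<sigma> q \<Longrightarrow> \<mu> p $ x = 0 \<or> \<mu> q $ x = 0"
  shows "hubbard T U (slater \<mu> \<sigma> L) = 0"
  unfolding hubbard_eq_0_iff[OF assms(1,2)]
proof (intro conjI allI)
  show "wave \<alpha> S (slater \<mu> \<sigma> L) \<in> mat_kernel T" for \<alpha> S
    using assms(4) dual_basis_in[OF assms(3)] by (intro wave_slater_in_kernel) auto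
  show "annih x \<beta> (annih x \<alpha> (slater \<mu> \<sigma> L)) = 0" for x \<alpha> \<beta>
  proof (cases "\<alpha> = \<beta>")
    case False
    have "annih x \<alpha> (slater \<mu> \<sigma> L) = 0 \<or> annih x \<beta> (slater \<mu> \<sigma> L) = 0"
    proof (cases "\<exists>p\<in>I. \<sigma> p = \<alpha> \<and> \<mu> p $ x \<noteq> 0")
      case True
      then have "annih x \<beta> (slater \<mu> \<sigma> L) = 0"
        using False assms(4,5) by (intro annih_slater_eq_0) blast
      then show ?thesis ..
    next
      case False
      then have "annih x \<alpha> (slater \<mu> \<sigma> L) = 0"
        using assms(4) by (intro annih_slater_eq_0) blast
      then show ?thesis ..
    qed
    then show ?thesis
      using annih_anticommute[of x \<beta> x \<alpha> "slater \<mu> \<sigma> L"] by auto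
  qed simp
qed

lemma slater_basis_nonzero:
  assumes "dual_basis K I \<mu>" "distinct L" "set L \<subseteq> I"
  shows "slater \<mu> \<sigma> L \<noteq> 0"
  using assms dual_basis_delta[OF assms(1)] by (intro slater_nonzero) blast+

text \<open>The sites exchangeable with \<open>p\<close> form a class closed under overlap, by
  \<open>exchangeable_overlap\<close> and \<open>exchangeable_trans\<close>. A proper class would be
  one half of a splitting.\<close>

lemma irreducible_exchangeable:
  fixes \<Phi> :: "('x::finite, 'n::{finite,linorder}) fock"
  assumes "confined \<mu> I (card I) \<Phi>" "\<And>x \<alpha> \<beta>. annih x \<beta> (annih x \<alpha> \<Phi>) = 0"
    and "\<nexists>A B. splits \<mu> I A B"
  shows "exchangeable y x \<Phi>"
proof (rule exchangeable_everywhere[OF assms(1)])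
  fix p q
  assume p: "p \<in> I" and q: "q \<in> I"
  define A where "A = {q \<in> I. exchangeable p q \<Phi>}"
  have "p \<in> A"
    using p by (simp add: A_def exchangeable_def assms(2))
  have "I - A = {}"
  proof (rule ccontr)
    assume "I - A \<noteq> {}"
    moreover have "\<not> splits \<mu> I A (I - A)"
      using assms(3) by blast
    ultimately obtain x a b where ab: "a \<in> A" "b \<in> I - A" "\<mu> a $ x \<noteq> 0" "\<mu> b $ x \<noteq> 0"
      using \<open>p \<in> A\<close> unfolding splits_def A_def by blast
    have "exchangeable a b \<Phi>"
      using ab assms(2) by (intro exchangeable_overlap[OF assms(1), where x = x]) (auto simp: A_def)
    then have "exchangeable p b \<Phi>"
      using exchangeable_trans[OF assms(1) p] ab by (auto simp: A_def)
    then show False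
      using ab by (simp add: A_def)
  qed
  then show "exchangeable p q \<Phi>"
    using q by (auto simp: A_def)
qed

theorem theorem1:
  fixes T P0 :: "complex ^ 'x::finite ^ 'x" and U :: real
  assumes "CARD('n::{finite,linorder}) \<ge> 2"
    and "U > 0"
    and "pos_semidef T"
    and "D0 = vec.dim (mat_kernel T)"
    and "D0 > 0"
    and "is_orth_proj P0 (mat_kernel T)"
    and "\<Lambda>0 = {x. P0 $ x $ x \<noteq> 0}"
  shows "SUN_ferromagnetism TYPE('n) T U D0 \<longleftrightarrow> irreducible_on P0 \<Lambda>0"
proof -
  let ?K = "mat_kernel T"
  note K = mat_kernel_subspace[of T]
  obtain I \<mu> where \<mu>: "dual_basis ?K I \<mu>" and card_I: "card I = D0"
    using dual_basis_exists[OF assms(6) K] assms(4) by metis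
  obtain \<alpha> \<beta> :: 'n where "\<alpha> \<noteq> \<beta>"
    using assms(1) by (metis (full_types) UNIV_I card_2_iff' card_le_Suc0_iff_eq finite not_less_eq_eq numeral_2_eq_2)
  have ground: "ground_state T U D0 \<Phi> \<longleftrightarrow> \<Phi> \<in> sector D0 \<and> \<Phi> \<noteq> 0 \<and> hubbard T U \<Phi> = 0"
    for \<Phi> :: "('x, 'n) fock"
  proof -
    obtain L where L: "set L = I" "distinct L"
      using finite_distinct_list[of I] by auto
    show ?thesis
    proof (rule ground_state_iff_zero_energy[OF assms(3,2)])
      \<comment> \<open>The trial state has a single color, so the disjointness condition of
        \<open>slater_zero_energy\<close> holds vacuously.\<close>
      show "slater \<mu> (\<lambda>_. \<alpha>) L \<in> sector D0"
        using slater_in_sector[of \<mu> "\<lambda>_. \<alpha>" L] L card_I distinct_card[of L] by simp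
      show "slater \<mu> (\<lambda>_. \<alpha>) L \<noteq> 0"
        using L by (intro slater_basis_nonzero[OF \<mu>]) auto
      show "hubbard T U (slater \<mu> (\<lambda>_. \<alpha>) L) = 0"
        using L by (intro slater_zero_energy[OF assms(3,2) \<mu>]) auto
    qed
  qed
  show ?thesis
    unfolding assms(7)
  proof
    assume irred: "irreducible_on P0 {x. P0 $ x $ x \<noteq> 0}"
    show "SUN_ferromagnetism TYPE('n) T U D0"
      unfolding SUN_ferromagnetism_def
    proof (intro allI impI conjI ballI)
      fix \<Phi> :: "('x, 'n) fock"
      assume "ground_state T U D0 \<Phi>"
      then have \<Phi>: "\<Phi> \<in> sector D0" "\<Phi> \<noteq> 0" "hubbard T U \<Phi> = 0"
        unfolding ground by auto
      have "exchangeable y x \<Phi>" for x y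
      proof (rule irreducible_exchangeable)
        show "confined \<mu> I (card I) \<Phi>"
          unfolding card_I by (rule zero_energy_confined[OF assms(3,2) \<mu> \<Phi>(1,3)])
        show "annih x \<beta> (annih x \<alpha> \<Phi>) = 0" for x \<alpha> \<beta>
          using \<Phi>(3) hubbard_eq_0_iff[OF assms(3,2)] by blast
        show "\<nexists>A B. splits \<mu> I A B"
          using splits_imp_reducible[OF assms(6) K \<mu>] irred by blast
      qed
      then show casimir: "casimir \<Phi> = of_real (max_casimir CARD('n) D0) *s \<Phi>"
        unfolding casimir_max_iff[OF \<Phi>(1)] exchangeable_def by blast
      \<comment> \<open>The ground state itself witnesses that the bound is attained.\<close>
      then show "max_casimir CARD('n) D0 \<in> eigenvalues_on (sector D0) (casimir :: ('x, 'n) fock \<Rightarrow> _)"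
        unfolding eigenvalues_on_def eigenvector_on_def using \<Phi> by blast
    qed (rule casimir_le_max)
  next
    assume ferro: "SUN_ferromagnetism TYPE('n) T U D0"
    show "irreducible_on P0 {x. P0 $ x $ x \<noteq> 0}"
    proof
      assume "reducible_on P0 {x. P0 $ x $ x \<noteq> 0}"
      then obtain A B where split: "splits \<mu> I A B"
        using reducible_imp_splits[OF assms(6) K \<mu>] by blast
      then obtain p q where pq: "p \<in> A" "q \<in> B"
        unfolding splits_def by blast
      have I: "I = A \<union> B" "A \<inter> B = {}"
        and sep: "\<And>x p q. p \<in> A \<Longrightarrow> q \<in> B \<Longrightarrow> \<mu> p $ x = 0 \<or> \<mu> q $ x = 0"
        using split unfolding splits_def by auto
      define \<sigma> where "\<sigma> z = (if z \<in> A then \<alpha> else \<beta>)" for z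
      \<comment> \<open>One site of each half goes to the front of the list, so that
        \<open>annih_slater_head\<close> removes \<open>p\<close> and then \<open>q\<close>.\<close>
      obtain M where M: "set M = I - {p, q}" "distinct M"
        using finite_distinct_list[of "I - {p, q}"] by auto
      define \<Phi> where "\<Phi> = slater \<mu> \<sigma> (p # q # M)"
      have "p \<noteq> q"
        using pq I by auto
      have L: "set (p # q # M) = I" "distinct (p # q # M)"
        using M pq I \<open>p \<noteq> q\<close> by auto
      have \<Phi>: "\<Phi> \<in> sector D0"
        unfolding \<Phi>_def using slater_in_sector[of \<mu> \<sigma> "p # q # M"] distinct_card[OF L(2)] L(1) card_I
        by simp
      have "\<Phi> \<noteq> 0"
        unfolding \<Phi>_def using L by (intro slater_basis_nonzero[OF \<mu>]) auto
      moreover have "hubbard T U \<Phi> = 0"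
        unfolding \<Phi>_def
      proof (rule slater_zero_energy[OF assms(3,2) \<mu> L(1)])
        show "\<mu> a $ x = 0 \<or> \<mu> b $ x = 0" if "a \<in> I" "b \<in> I" "\<sigma> a \<noteq> \<sigma> b" for a b x
          using that sep I by (auto simp: \<sigma>_def split: if_splits)
      qed
      ultimately have "casimir \<Phi> = of_real (max_casimir CARD('n) D0) *s \<Phi>"
        using ferro ground \<Phi> unfolding SUN_ferromagnetism_def by blast
      \<comment> \<open>The left side equals the nonzero state
        \<open>slater \<mu> \<sigma> M\<close>, while the right side vanishes because no orbital of
        color \<beta> reaches \<open>p\<close>.\<close>
      then have exchange: "annih q \<beta> (annih p \<alpha> \<Phi>) = annih q \<alpha> (annih p \<beta> \<Phi>)"
        unfolding casimir_max_iff[OF \<Phi>] by blast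
      have "annih p \<beta> \<Phi> = 0"
        unfolding \<Phi>_def
      proof (rule annih_slater_eq_0)
        show "\<mu> z $ p = 0" if "z \<in> set (p # q # M)" "\<sigma> z = \<beta>" for z
          using that L(1) I pq \<open>\<alpha> \<noteq> \<beta>\<close> dual_basis_delta[OF \<mu>, of z p]
          by (auto simp: \<sigma>_def split: if_splits)
      qed
      moreover have "annih p \<alpha> \<Phi> = slater \<mu> \<sigma> (q # M)"
      proof -
        have "annih p (\<sigma> p) \<Phi> = slater \<mu> \<sigma> (q # M)"
          unfolding \<Phi>_def using L dual_basis_delta[OF \<mu>] by (intro annih_slater_head) auto
        then show ?thesis
          using pq by (simp add: \<sigma>_def)
      qed
      moreover have "annih q \<beta> (slater \<mu> \<sigma> (q # M)) = slater \<mu> \<sigma> M"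
      proof -
        have "annih q (\<sigma> q) (slater \<mu> \<sigma> (q # M)) = slater \<mu> \<sigma> M"
          using L dual_basis_delta[OF \<mu>] by (intro annih_slater_head) auto
        moreover have "\<sigma> q = \<beta>"
          using pq I by (auto simp: \<sigma>_def)
        ultimately show ?thesis
          by simp
      qed
      ultimately have "slater \<mu> \<sigma> M = 0"
        using exchange by simp
      moreover have "slater \<mu> \<sigma> M \<noteq> 0"
        using M by (intro slater_basis_nonzero[OF \<mu>]) auto
      ultimately show False
        by contradiction
    qed
  qed
qed

end
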